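(* Let $N\ge2$ be an integer, $1<p<N$, $\alpha\in\mathbb{R}$ and $p-1<q<\frac{(N+\alpha)p}{N-p}-1$. Then the equation $-\Delta_p u=|x|^{\alpha}u^q$ has no positive radial solution in $\mathbb{R}^N$.
   Context: $\Delta_p u=\mathrm{div}(|\nabla u|^{p-2}\nabla u)$. A solution of $-\Delta_p u=|x|^\alpha u^q$ in $\Omega$ always means a continuous solution: $u$ is continuous in $\Omega$, $\nabla u\in L^p_{loc}(\Omega)$, and $\int_\Omega|\nabla u|^{p-2}\nabla u\cdot\nabla\phi\,dx=\int_\Omega|x|^\alpha u^q\phi\,dx$ for all $\phi\in C_c^\infty(\Omega)$; here $\Omega=\mathbb{R}^N$. *)

theory Defs
  imports "HOL-Analysis.Analysis"
begin

text \<open>In all definitions below \<open>\<Omega>\<close> is meant to be an open set. Real powers are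
  written with \<open>powr\<close>, whose value at base \<open>0\<close> is \<open>0\<close>. This is the right convention for
  \<open>|\<nabla>u|\<^sup>p\<^sup>-\<^sup>2\<nabla>u\<close>, which is \<open>0\<close> where \<open>\<nabla>u = 0\<close>, and it is immaterial for \<open>|x|\<^sup>\<alpha>\<close>, where it
  affects only the single point \<open>x = 0\<close>.\<close>

primrec Ck_on :: "nat \<Rightarrow> 'a::euclidean_space set \<Rightarrow> ('a \<Rightarrow> real) \<Rightarrow> bool" where
  "Ck_on 0 \<Omega> f \<longleftrightarrow> continuous_on \<Omega> f"
| "Ck_on (Suc k) \<Omega> f \<longleftrightarrow>
     (\<forall>x\<in>\<Omega>. f differentiable at x) \<and>
     (\<forall>v. Ck_on k \<Omega> (\<lambda>x. frechet_derivative f (at x) v))"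

definition smooth :: "('a::euclidean_space \<Rightarrow> real) \<Rightarrow> bool" where
  "smooth f \<longleftrightarrow> (\<forall>k. Ck_on k UNIV f)"

text \<open>\<open>C\<^sub>c\<^sup>\<infinity>(\<Omega>)\<close>; its elements are extended by zero to the whole space.\<close>

definition test_function :: "'a::euclidean_space set \<Rightarrow> ('a \<Rightarrow> real) \<Rightarrow> bool" where
  "test_function \<Omega> \<phi> \<longleftrightarrow>
     smooth \<phi> \<and> compact (closure {x. \<phi> x \<noteq> 0}) \<and> closure {x. \<phi> x \<noteq> 0} \<subseteq> \<Omega>"

definition grad :: "('a::euclidean_space \<Rightarrow> real) \<Rightarrow> 'a \<Rightarrow> 'a" where
  "grad \<phi> x = (\<Sum>b\<in>Basis. frechet_derivative \<phi> (at x) b *\<^sub>R b)"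

text \<open>Elements of \<open>L\<^sup>p\<^sub>l\<^sub>o\<^sub>c\<close> are represented by Borel functions, which is no restriction as every
  Lebesgue measurable function agrees almost everywhere with a Borel one.\<close>

definition Lp_loc ::
    "real \<Rightarrow> 'a::euclidean_space set \<Rightarrow> ('a \<Rightarrow> 'b::euclidean_space) \<Rightarrow> bool" where
  "Lp_loc p \<Omega> f \<longleftrightarrow>
     set_borel_measurable lborel \<Omega> f \<and>
     (\<forall>K. compact K \<and> K \<subseteq> \<Omega> \<longrightarrow> set_integrable lborel K (\<lambda>x. norm (f x) powr p))"

text \<open>\<open>G\<close> is (a representative of) the distributional gradient of \<open>u\<close> in \<open>\<Omega>\<close>.\<close>

definition weak_gradient ::
    "'a::euclidean_space set \<Rightarrow> ('a \<Rightarrow> real) \<Rightarrow> ('a \<Rightarrow> 'a) \<Rightarrow> bool" where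
  "weak_gradient \<Omega> u G \<longleftrightarrow>
     Lp_loc 1 \<Omega> u \<and> Lp_loc 1 \<Omega> G \<and>
     (\<forall>\<phi>. test_function \<Omega> \<phi> \<longrightarrow> (\<forall>b\<in>Basis.
        (LINT x:\<Omega>|lborel. u x * (grad \<phi> x \<bullet> b)) = - (LINT x:\<Omega>|lborel. (G x \<bullet> b) * \<phi> x)))"

text \<open>Continuous solutions of \<open>-\<Delta>\<^sub>p u = |x|\<^sup>\<alpha> u\<^sup>q\<close> in \<open>\<Omega>\<close>, for \<open>u \<ge> 0\<close>. Integrability is required
  explicitly because the Bochner integral of a non-integrable function is \<open>0\<close>. On the left it
  always holds, by Hoelder's inequality; on the right, for \<open>q \<ge> 0\<close>, it can fail only if
  \<open>\<alpha> \<le> - N\<close> with \<open>N\<close> the dimension.\<close>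

definition p_laplace_solution ::
    "real \<Rightarrow> real \<Rightarrow> real \<Rightarrow> 'a::euclidean_space set \<Rightarrow> ('a \<Rightarrow> real) \<Rightarrow> bool" where
  "p_laplace_solution p \<alpha> q \<Omega> u \<longleftrightarrow>
     continuous_on \<Omega> u \<and>
     (\<exists>G. weak_gradient \<Omega> u G \<and> Lp_loc p \<Omega> G \<and>
       (\<forall>\<phi>. test_function \<Omega> \<phi> \<longrightarrow>
          set_integrable lborel \<Omega> (\<lambda>x. (norm (G x) powr (p - 2) *\<^sub>R G x) \<bullet> grad \<phi> x) \<and>
          set_integrable lborel \<Omega> (\<lambda>x. norm x powr \<alpha> * u x powr q * \<phi> x) \<and>
          (LINT x:\<Omega>|lborel. (norm (G x) powr (p - 2) *\<^sub>R G x) \<bullet> grad \<phi> x) =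
          (LINT x:\<Omega>|lborel. norm x powr \<alpha> * u x powr q * \<phi> x)))"

definition radial :: "('a::euclidean_space \<Rightarrow> real) \<Rightarrow> bool" where
  "radial u \<longleftrightarrow> (\<exists>v :: real \<Rightarrow> real. \<forall>x. u x = v (norm x))"

end

theory Submission
  imports Defs
begin

text \<open>
  Write \<open>N\<close> for the dimension. A positive radial solution is \<open>u x = v (norm x)\<close>, and formally the
  equation says that the flux \<open>r\<^sup>N\<^sup>-\<^sup>1 |v'|\<^sup>p\<^sup>-\<^sup>2 v'\<close> equals \<open>- F r\<close>, where \<open>F r\<close> is the integral of
  \<open>s\<^sup>N\<^sup>-\<^sup>1\<^sup>+\<^sup>\<alpha> v(s)\<^sup>q\<close> over \<open>[0, r]\<close>. Hence \<open>v\<close> decreases, so \<open>F r\<close> is at least a multiple of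
  \<open>r\<^sup>N\<^sup>+\<^sup>\<alpha> v(r)\<^sup>q\<close>. Inserted in the equation for \<open>v'\<close> this is a differential inequality; as
  \<open>q > p - 1\<close>, integrating it from \<open>0\<close> bounds \<open>v\<close> by a multiple of \<open>r powr (- (p + \<alpha>) / (q - p + 1))\<close>.
  The Pohozaev function
  \<open>(p - 1)/p * r\<^sup>N |v'|\<^sup>p + r\<^sup>N\<^sup>+\<^sup>\<alpha> v\<^sup>q\<^sup>+\<^sup>1 / (q + 1) - (N - p)/p * v F\<close>
  has the derivative \<open>((N + \<alpha>)/(q + 1) - (N - p)/p) r\<^sup>N\<^sup>+\<^sup>\<alpha>\<^sup>-\<^sup>1 v\<^sup>q\<^sup>+\<^sup>1\<close>, which is positive exactly
  because \<open>q\<close> is subcritical. It is nonnegative near \<open>0\<close>, hence bounded below by a positive constant for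
  large radii; but the decay of \<open>v\<close> pushes it below every positive constant, again by
  subcriticality. This contradiction is the lemma \<open>radial_ode.no_entire_solution\<close>.

  The rest of the work is to reach the differential equation from the weak formulation, where the
  gradient \<open>G\<close> is only a locally integrable field known through its pairings with test functions. Two steps
  are needed.

  First, \<open>G\<close> itself is radial: \<open>G x = h (norm x) x / norm x\<close> almost everywhere, and \<open>h\<close> is the
  derivative of \<open>v\<close> in the integrated sense (\<open>gradient_radial_profile\<close>). Convolving \<open>u\<close> with a
  radial mollifier gives a radial function, as Lebesgue measure is invariant under isometries; its
  gradient is the mollification of \<open>G\<close> and is therefore radial in the classical sense. Mollifications
  converge in the mean, because translation is continuous in \<open>L\<^sup>1\<close>, and almost everywhere along a subsequence.

  Secondly, the equation is tested with functions \<open>\<psi> (x \<bullet> x)\<close>, which are smooth even at the origin.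
  The image of Lebesgue measure under the norm has as its density \<open>N r\<^sup>N\<^sup>-\<^sup>1\<close> times the volume of the unit
  ball, so the test gives a one-dimensional identity, and enough functions \<open>\<psi>\<close> give the flux identity
  for almost every \<open>r\<close> (\<open>flux_eq\<close>). As \<open>F\<close> is continuous, \<open>v\<close> is differentiable for \<open>r > 0\<close>. The
  test functions do not vanish at the origin; this is what yields the boundary condition that the flux vanishes there.
\<close>

section \<open>Lebesgue measure under isometries and under the norm\<close>

lemma distr_lborel_translate:
  fixes c :: "'a::euclidean_space"
  shows "distr lborel borel (\<lambda>x. x + c) = lborel"
  using lborel_affine[of 1 c] by (simp add: density_1 add.commute)

lemma distr_lborel_reflect:
  "distr lborel borel (\<lambda>x::'a::euclidean_space. c - x) = lborel"
  using lborel_affine[of "-1" c] by (simp add: density_1)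

lemma nn_integral_lborel_translate:
  fixes c :: "'a::euclidean_space"
  assumes [measurable]: "f \<in> borel_measurable borel"
  shows "(\<integral>\<^sup>+x. f (x + c) \<partial>lborel) = (\<integral>\<^sup>+x. f x \<partial>lborel)"
  by (subst (2) distr_lborel_translate[of c, symmetric]) (simp add: nn_integral_distr)

text \<open>Uniqueness of Haar measure: the image \<open>M\<close> of Lebesgue measure under an isometry is again
  translation invariant and gives the unit ball the same mass. Two applications of Fubini's theorem, with the unit
  ball as an auxiliary factor, then turn \<open>M A\<close> into the Lebesgue measure of \<open>A\<close>.\<close>

lemma lborel_orthogonal_invariant:
  fixes T :: "'a::euclidean_space \<Rightarrow> 'a"
  assumes T: "orthogonal_transformation T"
  shows "distr lborel borel T = lborel"
proof -
  define M where "M = distr lborel borel T"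
  have lin: "linear T" and nT: "\<And>x. norm (T x) = norm x"
    using T by (auto simp: orthogonal_transformation)
  have [measurable]: "T \<in> borel_measurable borel"
    using lin by (intro borel_measurable_continuous_onI linear_continuous_on)
      (simp add: linear_conv_bounded_linear)
  have setsM[measurable_cong]: "sets M = sets borel" by (simp add: M_def)
  obtain S where S: "\<And>y. T (S y) = y"
    using orthogonal_transformation_surj[OF T] by (metis surj_def)
  have ball: "emeasure M (ball 0 r) = emeasure lborel (ball (0::'a) r)" for r
  proof -
    have "T -` ball 0 r = ball (0::'a) r" by (auto simp: nT)
    then show ?thesis by (simp add: M_def emeasure_distr)
  qed
  have transM: "(\<integral>\<^sup>+x. f (x + y) \<partial>M) = (\<integral>\<^sup>+x. f x \<partial>M)"
    if [measurable]: "f \<in> borel_measurable borel" for f and y :: 'a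
  proof -
    have "(\<integral>\<^sup>+x. f (x + y) \<partial>M) = (\<integral>\<^sup>+x. f (T (x + S y)) \<partial>lborel)"
      by (simp add: M_def nn_integral_distr linear_add[OF lin] S)
    also have "\<dots> = (\<integral>\<^sup>+x. f (T x) \<partial>lborel)"
      by (rule nn_integral_lborel_translate) measurable
    also have "\<dots> = (\<integral>\<^sup>+x. f x \<partial>M)"
      by (simp add: M_def nn_integral_distr)
    finally show ?thesis .
  qed
  interpret M: sigma_finite_measure M
  proof
    show "\<exists>A. countable A \<and> A \<subseteq> sets M \<and> \<Union>A = space M \<and> (\<forall>a\<in>A. emeasure M a \<noteq> \<infinity>)"
    proof (intro exI[of _ "range (\<lambda>n::nat. ball 0 (real n))"] conjI ballI)
      show "\<Union> (range (\<lambda>n::nat. ball (0::'a) (real n))) = space M"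
        using reals_Archimedean2 by (auto simp: M_def)
    qed (auto simp: setsM ball emeasure_ball)
  qed
  interpret pair_sigma_finite M lborel ..
  have "emeasure M A = emeasure lborel A" if A[measurable]: "A \<in> sets borel" for A
  proof -
    let ?B = "ball (0::'a) 1"
    let ?\<beta> = "emeasure lborel ?B"
    define f g :: "'a \<Rightarrow> ennreal" where "f = indicator ?B" and "g = indicator A"
    have [measurable]: "f \<in> borel_measurable borel" "g \<in> borel_measurable borel"
      unfolding f_def g_def by (auto intro!: borel_measurable_indicator)
    have int_f: "(\<integral>\<^sup>+x. f x \<partial>M) = ?\<beta>" "(\<integral>\<^sup>+x. f x \<partial>lborel) = ?\<beta>"
      by (simp_all add: f_def ball setsM)
    have int_g: "(\<integral>\<^sup>+x. g x \<partial>M) = emeasure M A" "(\<integral>\<^sup>+x. g x \<partial>lborel) = emeasure lborel A"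
      by (simp_all add: g_def setsM)
    have f_sym: "f (y - x) = f (x + - y)" for x y
      by (auto simp: f_def indicator_def dist_norm norm_minus_commute)
    have "emeasure M A * ?\<beta> = (\<integral>\<^sup>+y. f y * (\<integral>\<^sup>+x. g x \<partial>M) \<partial>lborel)"
      by (simp add: nn_integral_multc int_f int_g mult.commute)
    also have "\<dots> = (\<integral>\<^sup>+y. (\<integral>\<^sup>+x. f y * g (x + y) \<partial>M) \<partial>lborel)"
      by (simp add: nn_integral_cmult transM[of g])
    also have "\<dots> = (\<integral>\<^sup>+x. (\<integral>\<^sup>+y. f y * g (x + y) \<partial>lborel) \<partial>M)"
      by (rule Fubini') measurable
    also have "\<dots> = (\<integral>\<^sup>+x. (\<integral>\<^sup>+y. f (y - x) * g y \<partial>lborel) \<partial>M)"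
    proof (rule nn_integral_cong)
      fix x
      show "(\<integral>\<^sup>+y. f y * g (x + y) \<partial>lborel) = (\<integral>\<^sup>+y. f (y - x) * g y \<partial>lborel)"
        using nn_integral_lborel_translate[of "\<lambda>y. f (y - x) * g y" x] by (simp add: add.commute)
    qed
    also have "\<dots> = (\<integral>\<^sup>+y. (\<integral>\<^sup>+x. f (y - x) * g y \<partial>M) \<partial>lborel)"
      by (subst Fubini') measurable
    also have "\<dots> = (\<integral>\<^sup>+y. (\<integral>\<^sup>+x. f (x + - y) \<partial>M) * g y \<partial>lborel)"
      by (simp only: f_sym) (simp add: nn_integral_multc)
    also have "\<dots> = ?\<beta> * emeasure lborel A"
      by (subst transM) (simp_all add: nn_integral_cmult int_f int_g)
    finally have "emeasure M A * ?\<beta> = emeasure lborel A * ?\<beta>" by (simp add: mult.commute)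
    moreover have "0 < ?\<beta>" "?\<beta> < \<infinity>"
      by (auto simp: emeasure_ball)
    ultimately show ?thesis
      by (auto simp: mult.commute[of _ ?\<beta>] ennreal_mult_cancel_left)
  qed
  then show ?thesis
    unfolding M_def[symmetric] by (intro measure_eqI) (auto simp: setsM)
qed

text \<open>Both measures give \<open>{..r}\<close> the volume of the ball of radius \<open>r\<close>. This replaces polar
  coordinates: only radial functions are ever integrated in these coordinates.\<close>

lemma distr_norm_lborel:
  "distr lborel borel (norm :: 'a::euclidean_space \<Rightarrow> real) =
   density lborel (\<lambda>r. ennreal (indicator {0..} r * (DIM('a) * unit_ball_vol DIM('a) * r ^ (DIM('a) - 1))))"
  (is "?L = density lborel ?d")
proof (rule measure_eqI_generator_eq[where E = "range (atMost :: real \<Rightarrow> _)" and A = "\<lambda>i::nat. {..real i}" and \<Omega> = UNIV])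
  let ?N = "DIM('a)" and ?V = "unit_ball_vol DIM('a)"
  have eq: "emeasure ?L {..r} = ennreal (if r < 0 then 0 else ?V * r ^ ?N)" for r
  proof -
    have "norm -` {..r} = cball (0::'a) r" by auto
    then have "emeasure ?L {..r} = emeasure lborel (cball (0::'a) r)"
      by (simp add: emeasure_distr)
    then show ?thesis
      by (auto simp: emeasure_cball)
  qed
  have eq': "emeasure (density lborel ?d) {..r} = ennreal (if r < 0 then 0 else ?V * r ^ ?N)" for r :: real
  proof (cases "r < 0")
    case True
    have "emeasure (density lborel ?d) {..r} = (\<integral>\<^sup>+x. ?d x * indicator {..r} x \<partial>lborel)"
      by (simp add: emeasure_density)
    also have "\<dots> = (\<integral>\<^sup>+x. 0 \<partial>(lborel :: real measure))"
      by (intro nn_integral_cong) (use True in \<open>auto simp: indicator_def\<close>)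
    finally show ?thesis using True by simp
  next
    case False
    have "emeasure (density lborel ?d) {..r} = (\<integral>\<^sup>+x. ?d x * indicator {..r} x \<partial>lborel)"
      by (simp add: emeasure_density)
    also have "\<dots> = (\<integral>\<^sup>+x. ennreal (?N * ?V * x ^ (?N - 1)) * indicator {0..r} x \<partial>lborel)"
      by (intro nn_integral_cong) (auto simp: indicator_def)
    also have "\<dots> = ennreal (?V * r ^ ?N - ?V * 0 ^ ?N)"
      using False by (intro nn_integral_FTC_Icc)
         (auto intro!: derivative_eq_intros simp: field_simps)
    finally show ?thesis using False by simp
  qed
  show "emeasure ?L X = emeasure (density lborel ?d) X" if "X \<in> range atMost" for X
    using that eq eq' by auto
  show "emeasure ?L {..real i} \<noteq> \<infinity>" for i by (simp add: eq)
  show "Int_stable (range (atMost :: real \<Rightarrow> _))" by (auto simp: Int_stable_def)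
  show "sets ?L = sigma_sets UNIV (range atMost)" "sets (density lborel ?d) = sigma_sets UNIV (range atMost)"
    by (simp_all add: borel_eq_atMost)
  show "(\<Union>i. {..real i}) = UNIV" using real_arch_simple by auto
qed auto

lemma
  fixes f :: "real \<Rightarrow> real"
  assumes [measurable]: "f \<in> borel_measurable borel"
  defines "\<omega> \<equiv> real DIM('a) * unit_ball_vol DIM('a)"
  shows integrable_norm_iff: "integrable lborel (\<lambda>x::'a::euclidean_space. f (norm x)) \<longleftrightarrow>
      set_integrable lborel {0..} (\<lambda>r. r ^ (DIM('a) - 1) * f r)"
    and integral_norm: "(LINT x|lborel. f (norm (x::'a))) = \<omega> * (LINT r:{0..}|lborel. r ^ (DIM('a) - 1) * f r)"
proof -
  let ?d = "\<lambda>r::real. indicator {0..} r * (\<omega> * r ^ (DIM('a) - 1))"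
  have \<omega>: "0 < \<omega>" by (simp add: \<omega>_def)
  have D: "distr lborel borel (norm :: 'a \<Rightarrow> real) = density lborel (\<lambda>r. ennreal (?d r))"
    by (simp add: distr_norm_lborel \<omega>_def)
  have d: "AE r in lborel. 0 \<le> ?d r" using \<omega> by (auto simp: indicator_def)
  have e: "?d r *\<^sub>R f r = \<omega> * (indicator {0..} r *\<^sub>R (r ^ (DIM('a) - 1) * f r))" for r by simp
  have "integrable lborel (\<lambda>x::'a. f (norm x)) \<longleftrightarrow> integrable (distr lborel borel (norm :: 'a \<Rightarrow> real)) f"
    by (simp add: integrable_distr_eq)
  also have "\<dots> \<longleftrightarrow> integrable lborel (\<lambda>r. ?d r *\<^sub>R f r)"
    unfolding D by (rule integrable_density) (use d in auto)
  finally show "integrable lborel (\<lambda>x::'a. f (norm x)) \<longleftrightarrow>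
      set_integrable lborel {0..} (\<lambda>r. r ^ (DIM('a) - 1) * f r)"
    unfolding e set_integrable_def using \<omega> by simp
  have "(LINT x|lborel. f (norm (x::'a))) = integral\<^sup>L (distr lborel borel (norm :: 'a \<Rightarrow> real)) f"
    by (simp add: integral_distr)
  also have "\<dots> = (\<integral>r. ?d r *\<^sub>R f r \<partial>lborel)"
    unfolding D by (rule integral_density) (use d in auto)
  finally show "(LINT x|lborel. f (norm (x::'a))) = \<omega> * (LINT r:{0..}|lborel. r ^ (DIM('a) - 1) * f r)"
    unfolding e set_lebesgue_integral_def by simp
qed

section \<open>Smooth functions, a flat exponential and radial test functions\<close>

lemma Ck_on_SucD: "Ck_on (Suc k) S f \<Longrightarrow> Ck_on k S f"
proof (induction k arbitrary: f)
  case 0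
  then show ?case
    by (auto intro!: differentiable_imp_continuous_on simp: differentiable_on_def differentiable_at_withinI)
qed auto

text \<open>Lets a derivative be exhibited instead of computing \<open>frechet_derivative\<close>.\<close>

lemma Ck_on_UNIV_SucI:
  fixes f :: "'a::euclidean_space \<Rightarrow> real"
  assumes "\<And>x. (f has_derivative f' x) (at x)" "\<And>v. Ck_on k UNIV (\<lambda>x. f' x v)"
  shows "Ck_on (Suc k) UNIV f"
proof -
  have "frechet_derivative f (at x) = f' x" for x
    using frechet_derivative_at[OF assms(1)] by simp
  with assms show ?thesis by (auto simp: differentiable_def)
qed

lemma smoothI: "(\<And>k. Ck_on k UNIV f) \<Longrightarrow> smooth f"
  by (simp add: smooth_def)

lemma smooth_differentiable: "smooth f \<Longrightarrow> f differentiable at x"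
  by (metis smooth_def Ck_on.simps(2) UNIV_I)

lemma smooth_has_derivative: "smooth f \<Longrightarrow> (f has_derivative frechet_derivative f (at x)) (at x)"
  using smooth_differentiable frechet_derivative_works by blast

lemma smooth_frechet_derivative: "smooth f \<Longrightarrow> smooth (\<lambda>x. frechet_derivative f (at x) v)"
  unfolding smooth_def by (metis Ck_on.simps(2))

lemma smooth_continuous_on: "smooth f \<Longrightarrow> continuous_on S f"
  by (metis smooth_def Ck_on.simps(1) continuous_on_subset subset_UNIV)

lemma Ck_on_const: "Ck_on k S (\<lambda>_. c)"
  by (induction k arbitrary: c) (auto simp: frechet_derivative_const)

lemma smooth_const: "smooth (\<lambda>_. c)"
  by (simp add: smooth_def Ck_on_const)

lemma smooth_linear:
  assumes "bounded_linear f" shows "smooth f"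
proof (rule smoothI)
  fix k show "Ck_on k UNIV f"
  proof (cases k)
    case 0
    then show ?thesis using assms by (simp add: linear_continuous_on)
  next
    case (Suc j)
    then show ?thesis
      using Ck_on_UNIV_SucI[OF bounded_linear_imp_has_derivative[OF assms] Ck_on_const] by simp
  qed
qed

lemma Ck_on_add:
  fixes f g :: "'a::euclidean_space \<Rightarrow> real"
  shows "Ck_on k UNIV f \<Longrightarrow> Ck_on k UNIV g \<Longrightarrow> Ck_on k UNIV (\<lambda>x. f x + g x)"
proof (induction k arbitrary: f g)
  case (Suc k)
  show ?case
  proof (rule Ck_on_UNIV_SucI)
    show "((\<lambda>x. f x + g x) has_derivative (\<lambda>v. frechet_derivative f (at x) v + frechet_derivative g (at x) v)) (at x)" for x
      using Suc.prems by (intro has_derivative_add) (auto simp: frechet_derivative_works)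
  qed (use Suc in auto)
qed (auto intro: continuous_intros)

lemma smooth_add:
  fixes f g :: "'a::euclidean_space \<Rightarrow> real"
  shows "smooth f \<Longrightarrow> smooth g \<Longrightarrow> smooth (\<lambda>x. f x + g x)"
  by (simp add: smooth_def Ck_on_add)

lemma Ck_on_mult:
  fixes f g :: "'a::euclidean_space \<Rightarrow> real"
  shows "Ck_on k UNIV f \<Longrightarrow> Ck_on k UNIV g \<Longrightarrow> Ck_on k UNIV (\<lambda>x. f x * g x)"
proof (induction k arbitrary: f g)
  case (Suc k)
  show ?case
  proof (rule Ck_on_UNIV_SucI)
    show "((\<lambda>x. f x * g x) has_derivative (\<lambda>v. f x * frechet_derivative g (at x) v + frechet_derivative f (at x) v * g x)) (at x)" for x
      using Suc.prems by (intro has_derivative_mult) (auto simp: frechet_derivative_works)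
    show "Ck_on k UNIV (\<lambda>x. f x * frechet_derivative g (at x) v + frechet_derivative f (at x) v * g x)" for v
      using Suc.prems by (intro Ck_on_add Suc.IH) (auto dest: Ck_on_SucD simp del: Ck_on.simps(2), auto)
  qed
qed (auto intro: continuous_intros)

lemma smooth_mult:
  fixes f g :: "'a::euclidean_space \<Rightarrow> real"
  shows "smooth f \<Longrightarrow> smooth g \<Longrightarrow> smooth (\<lambda>x. f x * g x)"
  by (simp add: smooth_def Ck_on_mult)

lemma smooth_has_real_derivative:
  assumes "smooth \<psi>"
  shows "(\<psi> has_real_derivative frechet_derivative \<psi> (at t) 1) (at t)"
proof -
  have "linear (frechet_derivative \<psi> (at t))"
    by (rule linear_frechet_derivative[OF smooth_differentiable[OF assms]])
  then have "frechet_derivative \<psi> (at t) x = x * frechet_derivative \<psi> (at t) 1" for x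
    using linear_scale[of "frechet_derivative \<psi> (at t)" x 1] by simp
  then have "frechet_derivative \<psi> (at t) = (*) (frechet_derivative \<psi> (at t) 1)"
    by (intro ext) (metis mult.commute)
  with smooth_has_derivative[OF assms] show ?thesis
    unfolding has_field_derivative_def by (rule back_subst[where P = "\<lambda>f. (\<psi> has_derivative f) (at t)"])
qed

text \<open>The induction runs over all outer functions at once, because the derivative of a composition contains
  the derivative of the outer function.\<close>

lemma Ck_on_compose_real:
  fixes f :: "'a::euclidean_space \<Rightarrow> real"
  assumes "smooth f"
  shows "smooth \<psi> \<Longrightarrow> Ck_on k UNIV (\<lambda>x. \<psi> (f x))"
proof (induction k arbitrary: \<psi>)
  case 0
  then show ?case
    using smooth_continuous_on[OF 0, of UNIV] smooth_continuous_on[OF assms, of UNIV]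
    by (auto intro: continuous_on_compose2)
next
  case (Suc k)
  show ?case
  proof (rule Ck_on_UNIV_SucI)
    show "((\<lambda>x. \<psi> (f x)) has_derivative (\<lambda>v. frechet_derivative f (at x) v * frechet_derivative \<psi> (at (f x)) 1)) (at x)" for x
      using has_derivative_compose[OF smooth_has_derivative[OF assms]
          smooth_has_real_derivative[OF Suc.prems, unfolded has_field_derivative_def]]
      by (simp add: mult.commute)
    show "Ck_on k UNIV (\<lambda>x. frechet_derivative f (at x) v * frechet_derivative \<psi> (at (f x)) 1)" for v
      using Suc.IH[OF smooth_frechet_derivative[OF Suc.prems]] smooth_frechet_derivative[OF assms]
      by (intro Ck_on_mult) (auto simp: smooth_def)
  qed
qed

lemma smooth_compose_real:
  fixes f :: "'a::euclidean_space \<Rightarrow> real"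
  shows "smooth \<psi> \<Longrightarrow> smooth f \<Longrightarrow> smooth (\<lambda>x. \<psi> (f x))"
  by (simp add: smoothI Ck_on_compose_real)

lemma smooth_antiderivative:
  assumes "smooth \<eta>" "\<And>t. (\<psi> has_real_derivative \<eta> t) (at t)"
  shows "smooth \<psi>"
proof (rule smoothI)
  fix k
  have "Ck_on (Suc k) UNIV \<psi>"
  proof (rule Ck_on_UNIV_SucI)
    show "(\<psi> has_derivative (\<lambda>v. \<eta> t * v)) (at t)" for t
      using assms(2) by (simp add: has_field_derivative_def)
    show "Ck_on k UNIV (\<lambda>t. \<eta> t * v)" for v
      using assms(1) by (intro Ck_on_mult Ck_on_const) (auto simp: smooth_def)
  qed
  then show "Ck_on k UNIV \<psi>" by (rule Ck_on_SucD)
qed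

lemma smooth_inner_self: "smooth (\<lambda>x::'a::euclidean_space. (x - a) \<bullet> (x - a))"
proof -
  have "smooth (\<lambda>x. \<Sum>b\<in>A. ((x - a) \<bullet> b) * ((x - a) \<bullet> b))" if "finite A" for A :: "'a set"
    using that
  proof induction
    case (insert b A)
    have "smooth (\<lambda>x. x \<bullet> b + - (a \<bullet> b))"
      by (intro smooth_add smooth_linear smooth_const bounded_linear_inner_left)
    then have "smooth (\<lambda>x. (x - a) \<bullet> b)" by (simp add: inner_diff_left)
    with insert show ?case by (simp add: smooth_add smooth_mult)
  qed (simp add: smooth_const)
  from this[OF finite_Basis] show ?thesis
    by (simp add: euclidean_inner[symmetric])
qed

text \<open>The factor \<open>inverse t ^ m\<close> makes the family closed under differentiation up to linear
  combinations (\<open>flat_exp_deriv\<close>), so that smoothness of every member follows by one induction.\<close>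

definition flat_exp :: "nat \<Rightarrow> real \<Rightarrow> real" where
  "flat_exp m t = (if 0 < t then exp (- inverse t) * inverse t ^ m else 0)"

lemma flat_exp_tendsto_zero: "(flat_exp m \<longlongrightarrow> 0) (at 0)"
proof (rule filterlim_split_at)
  show "(flat_exp m \<longlongrightarrow> 0) (at_left 0)"
    by (rule tendsto_eventually) (auto simp: flat_exp_def eventually_at_left_field intro!: exI[of _ "-1"])
  have "((\<lambda>t. inverse t ^ m / exp (inverse t)) \<longlongrightarrow> 0) (at_right (0::real))"
    by (rule filterlim_compose[OF tendsto_power_div_exp_0 filterlim_inverse_at_top_right])
  then show "(flat_exp m \<longlongrightarrow> 0) (at_right 0)"
    by (rule Lim_transform_eventually)
       (auto simp: flat_exp_def eventually_at_right_field exp_minus field_simps intro!: exI[of _ 1])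
qed

text \<open>At the origin the difference quotient of \<open>flat_exp m\<close> is \<open>flat_exp (m + 1)\<close>, which tends to \<open>0\<close>.\<close>

lemma flat_exp_deriv:
  "(flat_exp m has_real_derivative flat_exp (m + 2) t - m * flat_exp (m + 1) t) (at t)"
proof -
  consider "t < 0" | "t = 0" | "0 < t" by linarith
  then show ?thesis
  proof cases
    case 1
    have "((\<lambda>_. 0) has_real_derivative 0) (at t)" by simp
    then have "(flat_exp m has_real_derivative 0) (at t)"
      by (rule has_field_derivative_transform_within_open[where S = "{..<0}"]) 
         (use 1 in \<open>auto simp: flat_exp_def\<close>)
    with 1 show ?thesis by (simp add: flat_exp_def)
  next
    case 2
    have "((\<lambda>h. (flat_exp m (0 + h) - flat_exp m 0) / h) \<longlongrightarrow> 0) (at 0)"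
      by (rule Lim_transform_eventually[OF flat_exp_tendsto_zero[of "m + 1"]])
         (auto simp: flat_exp_def eventually_at field_simps intro!: exI[of _ 1])
    then show ?thesis using 2 by (simp add: DERIV_def flat_exp_def)
  next
    case 3
    have d1: "((\<lambda>t. exp (- inverse t)) has_real_derivative exp (- inverse t) * inverse t ^ 2) (at t)"
      using 3 by (auto intro!: derivative_eq_intros simp: power2_eq_square)
    have "((\<lambda>t. inverse t ^ m) has_real_derivative m * (- (inverse t ^ 2) * inverse t ^ (m - Suc 0))) (at t)"
      by (rule DERIV_power) (use 3 in \<open>auto intro!: derivative_eq_intros simp: power2_eq_square\<close>)
    moreover have "m * (- (inverse t ^ 2) * inverse t ^ (m - Suc 0)) = - (m * inverse t ^ (m + 1))"
      by (cases m) (auto simp: power2_eq_square)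
    ultimately have d2: "((\<lambda>t. inverse t ^ m) has_real_derivative - (m * inverse t ^ (m + 1))) (at t)"
      by (simp only:)
    have "((\<lambda>t. exp (- inverse t) * inverse t ^ m) has_real_derivative
        flat_exp (m + 2) t - m * flat_exp (m + 1) t) (at t)"
      using DERIV_mult'[OF d1 d2] 3 by (simp add: flat_exp_def power2_eq_square algebra_simps)
    then show ?thesis
      by (rule has_field_derivative_transform_within_open[where S = "{0<..}"]) 
         (use 3 in \<open>auto simp: flat_exp_def\<close>)
  qed
qed

lemma smooth_flat_exp: "smooth (flat_exp m)"
proof (rule smoothI)
  fix k show "Ck_on k UNIV (flat_exp m)"
  proof (induction k arbitrary: m)
    case 0
    show ?case by (simp, meson flat_exp_deriv DERIV_isCont continuous_at_imp_continuous_on)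
  next
    case (Suc k)
    show ?case
    proof (rule Ck_on_UNIV_SucI)
      show "(flat_exp m has_derivative (\<lambda>v. (flat_exp (m + 2) t + (- real m) * flat_exp (m + 1) t) * v)) (at t)" for t
        using flat_exp_deriv[of m t] by (simp add: has_field_derivative_def)
      show "Ck_on k UNIV (\<lambda>t. (flat_exp (m + 2) t + (- real m) * flat_exp (m + 1) t) * v)" for v
        by (intro Ck_on_mult Ck_on_add Ck_on_const Suc.IH)
    qed
  qed
qed

lemma frechet_derivative_radial:
  assumes "(\<psi> has_real_derivative d) (at ((x - a) \<bullet> (x - a)))"
  shows "frechet_derivative (\<lambda>x::'a::euclidean_space. \<psi> ((x - a) \<bullet> (x - a))) (at x) = (\<lambda>v. d * (2 * ((x - a) \<bullet> v)))"
proof (rule frechet_derivative_at[symmetric])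
  have "((\<lambda>x. (x - a) \<bullet> (x - a)) has_derivative (\<lambda>v. 2 * ((x - a) \<bullet> v))) (at x)"
    by (auto intro!: derivative_eq_intros simp: inner_commute)
  from has_derivative_compose[OF this assms[unfolded has_field_derivative_def]]
  show "((\<lambda>x. \<psi> ((x - a) \<bullet> (x - a))) has_derivative (\<lambda>v. d * (2 * ((x - a) \<bullet> v)))) (at x)" .
qed

lemma grad_radial:
  assumes "(\<psi> has_real_derivative d) (at ((x - a) \<bullet> (x - a)))"
  shows "grad (\<lambda>x::'a::euclidean_space. \<psi> ((x - a) \<bullet> (x - a))) x = (2 * d) *\<^sub>R (x - a)"
  unfolding grad_def frechet_derivative_radial[OF assms]
  by (subst (3) euclidean_representation[symmetric]) (simp add: scaleR_sum_right mult.assoc mult.left_commute)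

text \<open>Composing with \<open>(x - a) \<bullet> (x - a)\<close> instead of the norm keeps the function smooth at \<open>a\<close> for every
  smooth \<open>\<psi>\<close>.\<close>

lemma test_function_radial:
  assumes "smooth \<psi>" and zero: "\<And>t. R \<le> t \<Longrightarrow> \<psi> t = 0"
  shows "test_function UNIV (\<lambda>x::'a::euclidean_space. \<psi> ((x - a) \<bullet> (x - a)))"
  unfolding test_function_def
proof (intro conjI)
  show "smooth (\<lambda>x. \<psi> ((x - a) \<bullet> (x - a)))"
    by (rule smooth_compose_real[OF assms(1) smooth_inner_self])
  have "{x. \<psi> ((x - a) \<bullet> (x - a)) \<noteq> 0} \<subseteq> cball a (sqrt (max R 0))"
  proof
    fix x assume "x \<in> {x. \<psi> ((x - a) \<bullet> (x - a)) \<noteq> 0}"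
    with zero[of "(x - a) \<bullet> (x - a)"] have "(x - a) \<bullet> (x - a) \<le> max R 0" by fastforce
    then have "norm (x - a) \<le> sqrt (max R 0)" by (simp add: norm_eq_sqrt_inner)
    then show "x \<in> cball a (sqrt (max R 0))" by (simp add: dist_norm norm_minus_commute)
  qed
  then show "compact (closure {x. \<psi> ((x - a) \<bullet> (x - a)) \<noteq> 0})"
    using bounded_subset compact_closure bounded_cball by blast
qed simp

section \<open>Translation continuity in mean and mollification\<close>

lemma integrable_lborel_translate:
  fixes f :: "'a::euclidean_space \<Rightarrow> 'b::{banach, second_countable_topology}"
  assumes "integrable lborel f"
  shows "integrable lborel (\<lambda>x. f (x + t))"
  using assms by (intro integrable_distr[of "\<lambda>x. x + t" lborel borel]) (simp_all add: distr_lborel_translate)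

lemma integral_lborel_translate:
  fixes f :: "'a::euclidean_space \<Rightarrow> 'b::{banach, second_countable_topology}"
  assumes "f \<in> borel_measurable borel"
  shows "(LINT x|lborel. f (x + t)) = (LINT x|lborel. f x)"
  by (subst (2) distr_lborel_translate[of t, symmetric]) (simp add: integral_distr assms)

text \<open>The modulus of continuity of translations in the mean.\<close>

definition L1_modulus :: "('a::euclidean_space \<Rightarrow> 'b::euclidean_space) \<Rightarrow> 'a \<Rightarrow> real" where
  "L1_modulus f t = (LINT x|lborel. norm (f (x + t) - f x))"

lemma L1_modulus_nonneg: "0 \<le> L1_modulus f t"
  by (simp add: L1_modulus_def)

lemma L1_modulus_approx:
  assumes f: "integrable lborel f" and g: "integrable lborel g"
  shows "L1_modulus f t \<le> L1_modulus g t + 2 * (LINT x|lborel. norm (f x - g x))"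
proof -
  note int = integrable_lborel_translate[of _ t]
  have fg: "integrable lborel (\<lambda>x. norm (f x - g x))" using f g by simp
  have [measurable]: "f \<in> borel_measurable borel" "g \<in> borel_measurable borel" using f g by auto
  have "L1_modulus f t \<le> (LINT x|lborel. norm (g (x + t) - g x) + (norm (f (x + t) - g (x + t)) + norm (f x - g x)))"
    unfolding L1_modulus_def
  proof (rule integral_mono)
    show "norm (f (x + t) - f x) \<le> norm (g (x + t) - g x) + (norm (f (x + t) - g (x + t)) + norm (f x - g x))" for x
    proof -
      have "f (x + t) - f x = (g (x + t) - g x) + ((f (x + t) - g (x + t)) - (f x - g x))" by simp
      then show ?thesis
        by (metis norm_triangle_le norm_triangle_ineq4 add_left_mono)
    qed
  qed (use f g int[OF f] int[OF g] int[OF fg] fg in auto)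
  also have "\<dots> = L1_modulus g t + ((LINT x|lborel. norm (f (x + t) - g (x + t))) + (LINT x|lborel. norm (f x - g x)))"
    unfolding L1_modulus_def using f g int[OF f] int[OF g] int[OF fg] fg by simp
  also have "(LINT x|lborel. norm (f (x + t) - g (x + t))) = (LINT x|lborel. norm (f x - g x))"
    by (rule integral_lborel_translate) measurable
  finally show ?thesis by simp
qed

lemma L1_modulus_tendsto_of_approx:
  assumes f: "integrable lborel f"
    and approx: "\<And>e. 0 < e \<Longrightarrow> \<exists>g. integrable lborel g \<and> (L1_modulus g \<longlongrightarrow> 0) (at 0) \<and>
                   (LINT x|lborel. norm (f x - g x)) < e"
  shows "(L1_modulus f \<longlongrightarrow> 0) (at 0)"
proof (rule tendstoI)
  fix e :: real assume e: "0 < e"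
  then obtain g where g: "integrable lborel g" "(L1_modulus g \<longlongrightarrow> 0) (at 0)"
      "(LINT x|lborel. norm (f x - g x)) < e / 4"
    using approx[of "e / 4"] by auto
  have "\<forall>\<^sub>F t in at 0. L1_modulus g t < e / 2"
    using order_tendstoD(2)[OF g(2), of "e / 2"] e by simp
  then show "\<forall>\<^sub>F t in at 0. dist (L1_modulus f t) 0 < e"
  proof eventually_elim
    case (elim t)
    then show ?case using L1_modulus_approx[OF f g(1), of t] g(3) L1_modulus_nonneg[of f t] by simp
  qed
qed

text \<open>A point of an open set stays in it under small translations. As the translate has the same
  measure, the \<open>L\<^sup>1\<close> distance is twice the measure of the points that leave the set, and this tends to \<open>0\<close> by
  dominated convergence.\<close>

lemma L1_modulus_indicator_open:
  fixes U :: "'a::euclidean_space set" and c :: "'b::euclidean_space"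
  assumes U: "open U" "emeasure lborel U < \<infinity>"
  shows "(L1_modulus (\<lambda>x. indicator U x *\<^sub>R c) \<longlongrightarrow> 0) (at 0)"
proof -
  have [measurable]: "U \<in> sets borel" using U by simp
  let ?i = "indicat_real U"
  have i: "integrable lborel ?i" using U by simp
  note it = integrable_lborel_translate[OF i]
  have i2: "integrable lborel (\<lambda>x. 2 * norm c * (?i x * (1 - ?i (x + t))))" for t
    by (rule Bochner_Integration.integrable_bound[OF integrable_mult_right[OF i, of "2 * norm c"]])
       (measurable, auto simp: indicator_def)
  have eq: "L1_modulus (\<lambda>x. ?i x *\<^sub>R c) t = (LINT x|lborel. 2 * norm c * (?i x * (1 - ?i (x + t))))" for t
  proof -
    have "norm (?i (x + t) *\<^sub>R c - ?i x *\<^sub>R c) = 2 * norm c * (?i x * (1 - ?i (x + t))) + norm c * (?i (x + t) - ?i x)" for x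
      by (auto simp: indicator_def)
    then have "L1_modulus (\<lambda>x. ?i x *\<^sub>R c) t = (LINT x|lborel. 2 * norm c * (?i x * (1 - ?i (x + t))) + norm c * (?i (x + t) - ?i x))"
      by (simp add: L1_modulus_def)
    also have "\<dots> = (LINT x|lborel. 2 * norm c * (?i x * (1 - ?i (x + t)))) + (LINT x|lborel. norm c * (?i (x + t) - ?i x))"
      by (rule Bochner_Integration.integral_add[OF i2]) (use i it[of t] in auto)
    also have "(LINT x|lborel. norm c * (?i (x + t) - ?i x)) = 0"
      using i it[of t] integral_lborel_translate[of ?i t] by simp
    finally show ?thesis by simp
  qed
  have "((\<lambda>n. L1_modulus (\<lambda>x. ?i x *\<^sub>R c) (t n)) \<longlonglongrightarrow> 0)" if t: "t \<longlonglongrightarrow> 0" for t :: "nat \<Rightarrow> 'a"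
  proof -
    have "(\<lambda>n. LINT x|lborel. 2 * norm c * (?i x * (1 - ?i (x + t n)))) \<longlonglongrightarrow> (LINT x|(lborel::'a measure). 0)"
    proof (rule integral_dominated_convergence[where w = "\<lambda>x. 2 * norm c * ?i x"])
      show "AE x in lborel. (\<lambda>n. 2 * norm c * (?i x * (1 - ?i (x + t n)))) \<longlonglongrightarrow> 0"
      proof (rule AE_I2, cases)
        fix x assume x: "x \<in> U"
        have "(\<lambda>n. x + t n) \<longlonglongrightarrow> x" using tendsto_add[OF tendsto_const t, of x] by simp
        then have "\<forall>\<^sub>F n in sequentially. x + t n \<in> U"
          using U(1) x topological_tendstoD by blast
        then have "\<forall>\<^sub>F n in sequentially. 2 * norm c * (?i x * (1 - ?i (x + t n))) = 0"
          by eventually_elim simp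
        then show "(\<lambda>n. 2 * norm c * (?i x * (1 - ?i (x + t n)))) \<longlonglongrightarrow> 0"
          by (rule tendsto_eventually)
      qed simp
      show "AE x in lborel. norm (2 * norm c * (?i x * (1 - ?i (x + t n)))) \<le> 2 * norm c * ?i x" for n
        by (auto simp: indicator_def)
      show "integrable lborel (\<lambda>x. 2 * norm c * ?i x)"
        using i by (rule integrable_mult_right)
    qed measurable
    then show ?thesis by (simp add: eq)
  qed
  then show ?thesis
    by (auto simp: tendsto_at_iff_sequentially comp_def)
qed

text \<open>Open sets approximate Borel sets of finite measure from outside, and the property survives sums and
  \<open>L\<^sup>1\<close> limits, hence holds for all integrable functions.\<close>

lemma L1_modulus_tendsto_zero:
  fixes f :: "'a::euclidean_space \<Rightarrow> 'b::euclidean_space"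
  assumes "integrable lborel f"
  shows "(L1_modulus f \<longlongrightarrow> 0) (at 0)"
  using assms
proof (induction rule: integrable_induct)
  case (base A c)
  then have [measurable]: "A \<in> sets borel" by simp
  have intA: "integrable lborel (indicat_real A)" using base by simp
  show ?case
  proof (rule L1_modulus_tendsto_of_approx)
    fix e :: real assume e: "0 < e"
    define d where "d = e / (norm c + 1)"
    have d: "0 < d" using e by (simp add: d_def add_nonneg_pos)
    obtain U where U: "open U" "A \<subseteq> U" "emeasure lborel (U - A) < d"
      using outer_regular_lborel[OF _ d, of A] by auto
    have [measurable]: "U \<in> sets borel" using U by simp
    have "emeasure lborel U = emeasure lborel A + emeasure lborel (U - A)"
      using U by (subst plus_emeasure) (auto intro: arg_cong[where f = "emeasure lborel"])
    also have "\<dots> < \<infinity>" using base U(3) by (auto simp: less_top[symmetric] intro: order.strict_trans)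
    finally have fin: "emeasure lborel U < \<infinity>" .
    have "(LINT x|lborel. norm (indicator A x *\<^sub>R c - indicator U x *\<^sub>R c)) = (LINT x|lborel. indicator (U - A) x * norm c)"
      using U(2) by (intro Bochner_Integration.integral_cong) (auto simp: indicator_def)
    also have "\<dots> = measure lborel (U - A) * norm c" by simp
    also have "measure lborel (U - A) * norm c \<le> d * norm c"
    proof (rule mult_right_mono)
      show "measure lborel (U - A) \<le> d"
        unfolding measure_def by (rule enn2real_leI) (use U(3) d in \<open>auto intro: less_imp_le\<close>)
    qed simp
    also have "\<dots> < e"
    proof -
      have "0 < norm c + 1" "e * norm c < e * (norm c + 1)" using e by (simp_all add: add_nonneg_pos)
      then show ?thesis by (simp only: d_def times_divide_eq_left pos_divide_less_eq)
    qed
    finally show "\<exists>g. integrable lborel g \<and> (L1_modulus g \<longlongrightarrow> 0) (at 0) \<and>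
        (LINT x|lborel. norm (indicator A x *\<^sub>R c - g x)) < e"
      using L1_modulus_indicator_open[OF U(1) fin, of c] fin
      by (intro exI[of _ "\<lambda>x. indicator U x *\<^sub>R c"]) auto
  qed (use intA in simp)
next
  case (add f g)
  show ?case
  proof (rule tendsto_sandwich[OF _ _ tendsto_const])
    show "((\<lambda>t. L1_modulus f t + L1_modulus g t) \<longlongrightarrow> 0) (at 0)"
      using tendsto_add[OF add.IH] by simp
    show "\<forall>\<^sub>F t in at 0. L1_modulus (\<lambda>x. f x + g x) t \<le> L1_modulus f t + L1_modulus g t"
    proof (rule always_eventually, rule allI)
      fix t
      have "L1_modulus (\<lambda>x. f x + g x) t \<le> (LINT x|lborel. norm (f (x + t) - f x) + norm (g (x + t) - g x))"
        unfolding L1_modulus_def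
      proof (rule integral_mono)
        show "norm (f (x + t) + g (x + t) - (f x + g x)) \<le> norm (f (x + t) - f x) + norm (g (x + t) - g x)" for x
          by (rule norm_diff_triangle_ineq)
      qed (use add.hyps integrable_lborel_translate[OF add.hyps(1), of t] integrable_lborel_translate[OF add.hyps(2), of t] in auto)
      also have "\<dots> = L1_modulus f t + L1_modulus g t"
        unfolding L1_modulus_def using add.hyps integrable_lborel_translate[OF add.hyps(1), of t]
          integrable_lborel_translate[OF add.hyps(2), of t] by simp
      finally show "L1_modulus (\<lambda>x. f x + g x) t \<le> L1_modulus f t + L1_modulus g t" .
    qed
  qed (simp add: L1_modulus_nonneg)
next
  case (lim f s)
  show ?case
  proof (rule L1_modulus_tendsto_of_approx[OF lim.hyps(4)])
    fix e :: real assume e: "0 < e"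
    have "(\<lambda>i. LINT x|lborel. norm (f x - s i x)) \<longlonglongrightarrow> (LINT x|(lborel::'a measure). 0)"
    proof (rule integral_dominated_convergence[where w = "\<lambda>x. 3 * norm (f x)"])
      show "AE x in lborel. (\<lambda>i. norm (f x - s i x)) \<longlonglongrightarrow> 0"
      proof (rule AE_I2)
        fix x :: 'a
        have "(\<lambda>i. norm (f x - s i x)) \<longlonglongrightarrow> norm (f x - f x)"
          by (intro tendsto_intros lim.hyps(2)) simp
        then show "(\<lambda>i. norm (f x - s i x)) \<longlonglongrightarrow> 0" by simp
      qed
      show "AE x in lborel. norm (norm (f x - s i x)) \<le> 3 * norm (f x)" for i
      proof (rule AE_I2)
        fix x :: 'a
        show "norm (norm (f x - s i x)) \<le> 3 * norm (f x)"
          using lim.hyps(3)[of x i] norm_triangle_ineq4[of "f x" "s i x"] by simp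
      qed
    qed (use lim.hyps(1,4) in auto)
    then have "\<forall>\<^sub>F i in sequentially. (LINT x|lborel. norm (f x - s i x)) < e"
      using e by (intro order_tendstoD(2)) auto
    then obtain i where "(LINT x|lborel. norm (f x - s i x)) < e"
      by (auto simp: eventually_sequentially)
    then show "\<exists>g. integrable lborel g \<and> (L1_modulus g \<longlongrightarrow> 0) (at 0) \<and> (LINT x|lborel. norm (f x - g x)) < e"
      using lim.hyps(1) lim.IH by blast
  qed
qed

definition mollify :: "('a::euclidean_space \<Rightarrow> real) \<Rightarrow> ('a \<Rightarrow> 'b::euclidean_space) \<Rightarrow> 'a \<Rightarrow> 'b" where
  "mollify \<rho> f x = (LINT y|lborel. \<rho> (x - y) *\<^sub>R f y)"

lemma mollify_measurable:
  assumes [measurable]: "\<rho> \<in> borel_measurable borel" "f \<in> borel_measurable borel"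
  shows "mollify \<rho> f \<in> borel_measurable borel"
proof -
  have "(\<lambda>x. LINT y|lborel. \<rho> (x - y) *\<^sub>R f y) \<in> borel_measurable borel"
    by measurable
  then show ?thesis by (simp add: mollify_def[abs_def])
qed

text \<open>By Fubini's theorem the error in the mean is at most the average of the translation modulus over the
  support of the kernel.\<close>

lemma mollify_L1_error:
  fixes f :: "'a::euclidean_space \<Rightarrow> 'b::euclidean_space"
  assumes f: "integrable lborel f"
    and \<rho>_int: "integrable lborel \<rho>" and \<rho>1: "(LINT z|lborel. \<rho> z) = 1"
    and \<rho>_nonneg: "\<And>z. 0 \<le> \<rho> z" and \<rho>_bounded: "\<And>z. \<rho> z \<le> B"
    and \<rho>_supp: "\<And>z. \<delta> \<le> norm z \<Longrightarrow> \<rho> z = 0"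
    and e: "\<And>t. norm t < \<delta> \<Longrightarrow> L1_modulus f t \<le> e"
  shows "integrable lborel (\<lambda>x. mollify \<rho> f x - f x)"
    and "(LINT x|lborel. norm (mollify \<rho> f x - f x)) \<le> e"
proof -
  have [measurable]: "f \<in> borel_measurable borel" "\<rho> \<in> borel_measurable borel"
    using f \<rho>_int by auto
  note mollify_measurable[measurable]
  have int1: "integrable lborel (\<lambda>t. \<rho> t *\<^sub>R f (x - t))" for x
  proof (rule Bochner_Integration.integrable_bound[where f = "\<lambda>t. B *\<^sub>R f (x - t)"])
    show "integrable lborel (\<lambda>t. B *\<^sub>R f (x - t))"
      using f by (intro integrable_scaleR_right integrable_distr[of "\<lambda>t. x - t" lborel borel])
                 (simp_all add: distr_lborel_reflect)
    have "\<bar>\<rho> t\<bar> \<le> \<bar>B\<bar>" for t using \<rho>_nonneg[of t] \<rho>_bounded[of t] by simp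
    then show "AE t in lborel. norm (\<rho> t *\<^sub>R f (x - t)) \<le> norm (B *\<^sub>R f (x - t))"
      by (auto intro!: AE_I2 mult_right_mono)
  qed measurable
  have mol: "mollify \<rho> f x = (LINT t|lborel. \<rho> t *\<^sub>R f (x - t))" for x
  proof -
    have "(LINT t|lborel. \<rho> t *\<^sub>R f (x - t)) = (LINT y|distr lborel borel (\<lambda>y. x - y). \<rho> y *\<^sub>R f (x - y))"
      by (simp add: distr_lborel_reflect)
    also have "\<dots> = mollify \<rho> f x"
      by (subst integral_distr) (simp_all add: mollify_def)
    finally show ?thesis by simp
  qed
  have diff: "mollify \<rho> f x - f x = (LINT t|lborel. \<rho> t *\<^sub>R (f (x - t) - f x))" for x
    using int1[of x] \<rho>_int \<rho>1 by (simp add: mol scaleR_diff_right)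
  have e0: "0 \<le> e" if "0 < \<delta>"
    using e[of 0] that L1_modulus_nonneg[of f 0] by simp
  have "(\<integral>\<^sup>+x. norm (mollify \<rho> f x - f x) \<partial>lborel) \<le> (\<integral>\<^sup>+x. (\<integral>\<^sup>+t. ennreal (\<rho> t * norm (f (x - t) - f x)) \<partial>lborel) \<partial>lborel)"
  proof (rule nn_integral_mono)
    fix x
    have "integrable lborel (\<lambda>t. \<rho> t *\<^sub>R (f (x - t) - f x))"
      using int1[of x] \<rho>_int by (simp add: scaleR_diff_right)
    from integral_norm_bound_ennreal[OF this]
    show "ennreal (norm (mollify \<rho> f x - f x)) \<le> (\<integral>\<^sup>+t. ennreal (\<rho> t * norm (f (x - t) - f x)) \<partial>lborel)"
      using \<rho>_nonneg by (simp add: diff)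
  qed
  also have "\<dots> = (\<integral>\<^sup>+t. (\<integral>\<^sup>+x. ennreal (\<rho> t * norm (f (x - t) - f x)) \<partial>lborel) \<partial>lborel)"
    by (rule lborel_pair.Fubini') measurable
  also have "\<dots> \<le> (\<integral>\<^sup>+t. ennreal (\<rho> t * e) \<partial>lborel)"
  proof (rule nn_integral_mono)
    fix t :: 'a
    show "(\<integral>\<^sup>+x. ennreal (\<rho> t * norm (f (x - t) - f x)) \<partial>lborel) \<le> ennreal (\<rho> t * e)"
    proof (cases "norm t < \<delta>")
      case True
      have "integrable lborel (\<lambda>x. norm (f (x - t) - f x))"
        using f integrable_lborel_translate[OF f, of "- t"] by simp
      then have "(\<integral>\<^sup>+x. ennreal (\<rho> t * norm (f (x - t) - f x)) \<partial>lborel) = ennreal (\<rho> t * L1_modulus f (- t))"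
        using \<rho>_nonneg by (subst nn_integral_eq_integral) (auto simp: L1_modulus_def)
      also have "\<dots> \<le> ennreal (\<rho> t * e)"
        using e[of "- t"] True \<rho>_nonneg by (intro ennreal_leI mult_left_mono) auto
      finally show ?thesis .
    next
      case False
      then show ?thesis using \<rho>_supp[of t] by simp
    qed
  qed
  also have "\<dots> \<le> ennreal e"
  proof (cases "0 < \<delta>")
    case True
    have "(\<integral>\<^sup>+t. ennreal (\<rho> t * e) \<partial>lborel) = ennreal (LINT t|lborel. \<rho> t * e)"
      using \<rho>_int \<rho>_nonneg e0[OF True] by (intro nn_integral_eq_integral) auto
    then show ?thesis using \<rho>1 by simp
  next
    case False
    then have "\<rho> z = 0" for z by (intro \<rho>_supp) (use norm_ge_zero[of z] in linarith)
    then show ?thesis by simp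
  qed
  finally have bound: "(\<integral>\<^sup>+x. norm (mollify \<rho> f x - f x) \<partial>lborel) \<le> ennreal e" .
  show "integrable lborel (\<lambda>x. mollify \<rho> f x - f x)"
  proof (rule integrableI_bounded)
    show "(\<integral>\<^sup>+x. norm (mollify \<rho> f x - f x) \<partial>lborel) < \<infinity>"
      using bound le_less_trans ennreal_less_top by fastforce
  qed measurable
  have "0 < \<delta>"
  proof (rule ccontr)
    assume "\<not> 0 < \<delta>"
    then have "\<rho> z = 0" for z by (intro \<rho>_supp) (use norm_ge_zero[of z] in linarith)
    with \<rho>1 show False by simp
  qed
  then show "(LINT x|lborel. norm (mollify \<rho> f x - f x)) \<le> e"
    using bound e0 by (subst integral_eq_nn_integral) (auto intro!: enn2real_leI)
qed

lemma Lp_loc_measurable: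
  assumes "Lp_loc p UNIV f"
  shows "f \<in> borel_measurable borel"
  using assms by (simp add: Lp_loc_def set_borel_measurable_def)

lemma Lp_loc_1_set_integrable:
  assumes f: "Lp_loc 1 UNIV f" and K: "compact K"
  shows "set_integrable lborel K f"
proof -
  have [measurable]: "f \<in> borel_measurable borel" "K \<in> sets borel"
    using Lp_loc_measurable[OF f] compact_imp_closed[OF K] by auto
  have "set_integrable lborel K (\<lambda>x. norm (f x) powr 1)"
    using f K by (auto simp: Lp_loc_def)
  then have "integrable lborel (\<lambda>x. norm (indicator K x *\<^sub>R f x))"
    by (simp add: set_integrable_def)
  then show ?thesis
    unfolding set_integrable_def by (rule integrable_norm_cancel) measurable
qed

lemma flat_exp_nonneg: "0 \<le> flat_exp m t"
  by (simp add: flat_exp_def)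

lemma flat_exp_0_le_1: "flat_exp 0 t \<le> 1"
  by (simp add: flat_exp_def)

lemma flat_exp_pos: "0 < t \<Longrightarrow> 0 < flat_exp m t"
  by (simp add: flat_exp_def)

lemma flat_exp_eq_0: "t \<le> 0 \<Longrightarrow> flat_exp m t = 0"
  by (simp add: flat_exp_def)

lemma continuous_flat_exp: "continuous_on S (flat_exp m)"
  by (rule smooth_continuous_on[OF smooth_flat_exp])

lemma continuous_flat_exp_compose [continuous_intros]:
  "continuous_on S f \<Longrightarrow> continuous_on S (\<lambda>x. flat_exp m (f x))"
  by (rule continuous_on_compose2[OF continuous_flat_exp[of UNIV]]) auto

definition bump_mass :: "'a::euclidean_space itself \<Rightarrow> real \<Rightarrow> real" where
  "bump_mass _ \<delta> = (LINT y|(lborel :: 'a measure). flat_exp 0 (\<delta>\<^sup>2 - y \<bullet> y))"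

definition mollifier :: "real \<Rightarrow> 'a::euclidean_space \<Rightarrow> real" where
  "mollifier \<delta> z = flat_exp 0 (\<delta>\<^sup>2 - z \<bullet> z) / bump_mass TYPE('a) \<delta>"

lemma inner_diff_self_commute: "(x - y) \<bullet> (x - y) = (y - x) \<bullet> (y - (x::'a::real_inner))"
  by (metis dot_square_norm norm_minus_commute)

context
  fixes \<delta> :: real
  assumes \<delta>: "0 < \<delta>"
begin

lemma inner_self_ge: "\<delta> \<le> norm z \<Longrightarrow> \<delta>\<^sup>2 - z \<bullet> z \<le> 0"
  using \<delta> by (simp add: dot_square_norm power_mono)

lemma bump_integrable: "integrable lborel (\<lambda>y::'a::euclidean_space. flat_exp 0 (\<delta>\<^sup>2 - y \<bullet> y))"
proof -
  have "integrable lborel (\<lambda>y. indicator (cball 0 \<delta>) y *\<^sub>R flat_exp 0 (\<delta>\<^sup>2 - (y::'a) \<bullet> y))"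
    by (rule borel_integrable_compact) (auto intro!: continuous_intros)
  also have "(\<lambda>y. indicator (cball 0 \<delta>) y *\<^sub>R flat_exp 0 (\<delta>\<^sup>2 - (y::'a) \<bullet> y)) = (\<lambda>y. flat_exp 0 (\<delta>\<^sup>2 - y \<bullet> y))"
  proof (rule ext)
    fix y :: 'a
    show "indicator (cball 0 \<delta>) y *\<^sub>R flat_exp 0 (\<delta>\<^sup>2 - y \<bullet> y) = flat_exp 0 (\<delta>\<^sup>2 - y \<bullet> y)"
      by (cases "y \<in> cball 0 \<delta>") (simp_all add: flat_exp_eq_0[OF inner_self_ge])
  qed
  finally show ?thesis .
qed

lemma bump_mass_pos: "0 < bump_mass TYPE('a::euclidean_space) \<delta>"
proof -
  let ?f = "\<lambda>y::'a. flat_exp 0 (\<delta>\<^sup>2 - y \<bullet> y)"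
  have "0 \<le> bump_mass TYPE('a) \<delta>"
    by (simp add: bump_mass_def integral_nonneg flat_exp_nonneg)
  moreover have "bump_mass TYPE('a) \<delta> \<noteq> 0"
  proof
    assume "bump_mass TYPE('a) \<delta> = 0"
    then have "AE y in lborel. ?f y = 0"
      unfolding bump_mass_def
      by (subst (asm) integral_nonneg_eq_0_iff_AE[OF bump_integrable]) (auto simp: flat_exp_nonneg)
    then have "AE y in lborel. (y::'a) \<notin> ball 0 \<delta>"
    proof eventually_elim
      case (elim y)
      have "0 < \<delta>\<^sup>2 - y \<bullet> y" if "norm y < \<delta>"
        using that \<delta> by (simp add: dot_square_norm power_strict_mono)
      with elim flat_exp_pos[of "\<delta>\<^sup>2 - y \<bullet> y" 0] show ?case by auto
    qed
    moreover have "{y \<in> space lborel. \<not> y \<notin> ball (0::'a) \<delta>} = ball 0 \<delta>" by auto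
    ultimately have "emeasure lborel (ball (0::'a) \<delta>) = 0"
      by (subst (asm) AE_iff_measurable) auto
    then show False using \<delta> unit_ball_vol_pos[of "real DIM('a)"] by (simp add: emeasure_ball)
  qed
  ultimately show ?thesis by simp
qed

lemma mollifier_nonneg: "0 \<le> mollifier \<delta> (z::'a::euclidean_space)"
  using bump_mass_pos[where 'a = 'a] by (simp add: mollifier_def flat_exp_nonneg)

lemma mollifier_le: "mollifier \<delta> (z::'a::euclidean_space) \<le> 1 / bump_mass TYPE('a) \<delta>"
  using bump_mass_pos[where 'a = 'a] unfolding mollifier_def by (intro divide_right_mono flat_exp_0_le_1) (simp add: less_imp_le)

lemma mollifier_eq_0: "\<delta> \<le> norm z \<Longrightarrow> mollifier \<delta> z = 0"
  by (simp add: mollifier_def flat_exp_eq_0[OF inner_self_ge])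

lemma mollifier_integrable: "integrable lborel (mollifier \<delta>)"
  unfolding mollifier_def[abs_def] by (intro integrable_divide bump_integrable)

lemma mollifier_integral: "(LINT z|lborel. mollifier \<delta> (z::'a::euclidean_space)) = 1"
proof -
  have "(LINT z|lborel. mollifier \<delta> (z::'a)) = bump_mass TYPE('a) \<delta> / bump_mass TYPE('a) \<delta>"
    unfolding mollifier_def bump_mass_def by (rule integral_divide_zero)
  then show ?thesis using bump_mass_pos[where 'a = 'a] by simp
qed

lemma continuous_mollifier [continuous_intros]:
  "continuous_on S f \<Longrightarrow> continuous_on S (\<lambda>x. mollifier \<delta> (f x))"
  unfolding mollifier_def divide_inverse by (intro continuous_intros)

lemma mollifier_measurable [measurable]: "mollifier \<delta> \<in> borel_measurable borel"
  using continuous_mollifier[OF continuous_on_id] by (rule borel_measurable_continuous_onI)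

lemma mollifier_mult_integrable:
  fixes G :: "'a::euclidean_space \<Rightarrow> 'b::euclidean_space"
  assumes G: "Lp_loc 1 UNIV G"
  shows "integrable lborel (\<lambda>y. mollifier \<delta> (x - y) *\<^sub>R G y)"
proof -
  have [measurable]: "G \<in> borel_measurable borel" by (rule Lp_loc_measurable[OF G])
  let ?c = "1 / bump_mass TYPE('a) \<delta>"
  have K: "integrable lborel (\<lambda>y. ?c *\<^sub>R (indicator (cball x \<delta>) y *\<^sub>R G y))"
    using Lp_loc_1_set_integrable[OF G compact_cball[of x \<delta>]]
    unfolding set_integrable_def by (rule integrable_scaleR_right)
  show ?thesis
  proof (rule Bochner_Integration.integrable_bound[OF K])
    show "AE y in lborel. norm (mollifier \<delta> (x - y) *\<^sub>R G y) \<le> norm (?c *\<^sub>R (indicator (cball x \<delta>) y *\<^sub>R G y))"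
    proof (rule AE_I2)
      fix y :: 'a
      show "norm (mollifier \<delta> (x - y) *\<^sub>R G y) \<le> norm (?c *\<^sub>R (indicator (cball x \<delta>) y *\<^sub>R G y))"
      proof (cases "y \<in> cball x \<delta>")
        case True
        have "\<bar>mollifier \<delta> (x - y)\<bar> \<le> \<bar>?c\<bar>"
          using mollifier_nonneg[of "x - y"] mollifier_le[of "x - y"] by linarith
        then have "\<bar>mollifier \<delta> (x - y)\<bar> * norm (G y) \<le> \<bar>?c\<bar> * norm (G y)"
          by (rule mult_right_mono) simp
        then show ?thesis using True by simp
      next
        case False
        then have "mollifier \<delta> (x - y) = 0" by (intro mollifier_eq_0) (simp add: dist_norm)
        then show ?thesis by simp
      qed
    qed
  qed measurable
qed

lemma mollify_mollifier_inner:
  fixes G :: "'a::euclidean_space \<Rightarrow> 'b::euclidean_space"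
  assumes G: "Lp_loc 1 UNIV G"
  shows "mollify (mollifier \<delta>) G x \<bullet> b = (LINT y|lborel. (G y \<bullet> b) * mollifier \<delta> (x - y))"
  unfolding mollify_def
  using integral_inner_left[OF mollifier_mult_integrable[OF G, of x], of b] by (simp add: mult.commute)

text \<open>
  The derivative falls on the kernel by differentiation under the integral, and the kernel
  \<open>y \<mapsto> mollifier \<delta> (x - y)\<close> is a test function, so the definition of the weak gradient replaces \<open>u\<close> and the
  differentiated kernel by \<open>G\<close> and the kernel.
\<close>

lemma
  fixes u :: "'a::euclidean_space \<Rightarrow> real"
  assumes u: "continuous_on UNIV u" and G: "weak_gradient UNIV u G" and b: "b \<in> Basis"
  shows mollify_has_directional_derivative:
      "((\<lambda>t. mollify (mollifier \<delta>) u (x + t *\<^sub>R b)) has_real_derivative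
          mollify (mollifier \<delta>) G (x + t0 *\<^sub>R b) \<bullet> b) (at t0)"
    and isCont_mollify_along_line: "isCont (\<lambda>t. mollify (mollifier \<delta>) G (x + t *\<^sub>R b) \<bullet> b) t0"
proof -
  define Z where "Z = bump_mass TYPE('a) \<delta>"
  define \<psi> where "\<psi> = (\<lambda>s. flat_exp 0 (\<delta>\<^sup>2 - s) / Z)"
  define \<psi>' where "\<psi>' = (\<lambda>s. - flat_exp 2 (\<delta>\<^sup>2 - s) / Z)"
  have d\<psi>: "(\<psi> has_real_derivative \<psi>' s) (at s)" for s
  proof -
    have "((\<lambda>s. flat_exp 0 (\<delta>\<^sup>2 - s)) has_real_derivative flat_exp 2 (\<delta>\<^sup>2 - s) * (- 1)) (at s)"
      by (rule DERIV_chain2[where f = "flat_exp 0"])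
         (use flat_exp_deriv[of 0 "\<delta>\<^sup>2 - s"] in \<open>auto intro!: derivative_eq_intros simp: numeral_2_eq_2\<close>)
    from DERIV_cdivide[OF this] show ?thesis by (simp add: \<psi>_def \<psi>'_def)
  qed
  have smooth: "smooth \<psi>"
  proof -
    have "smooth (\<lambda>s. \<delta>\<^sup>2 + - s)"
      by (intro smooth_add smooth_const smooth_linear bounded_linear_minus bounded_linear_ident)
    then have "smooth (\<lambda>s. flat_exp 0 (\<delta>\<^sup>2 - s) * inverse Z)"
      by (intro smooth_mult smooth_const smooth_compose_real[OF smooth_flat_exp]) simp
    then show ?thesis by (simp add: \<psi>_def divide_inverse)
  qed
  have moll: "mollifier \<delta> (x' - y) = \<psi> ((y - x') \<bullet> (y - x'))" for x' y :: 'a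
    unfolding mollifier_def \<psi>_def Z_def by (subst inner_diff_self_commute) (rule refl)
  \<comment> \<open>For parameters in a bounded interval all kernels live in one box, as differentiation under the
    integral sign requires.\<close>
  define M where "M = \<bar>t0\<bar> + 1"
  define I where "I = {- M<..<M}"
  have t0: "t0 \<in> I" and I: "convex I" "open I" by (auto simp: I_def M_def)
  obtain c where c: "cball x (M + \<delta>) \<subseteq> cbox (- c) c"
    using bounded_subset_cbox_symmetric[OF bounded_cball] by metis
  have out: "\<delta> \<le> norm (x + t *\<^sub>R b - y)" if "t \<in> I" "y \<notin> cbox (- c) c" for t y
  proof -
    have "M + \<delta> < norm (x - y)" using that(2) c by (auto simp: dist_norm subset_iff not_le[symmetric])
    moreover have "norm (x - y) \<le> norm (x + t *\<^sub>R b - y) + norm (t *\<^sub>R b)"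
      using norm_triangle_ineq4[of "x + t *\<^sub>R b - y" "t *\<^sub>R b"] by (simp add: algebra_simps)
    moreover have "norm (t *\<^sub>R b) \<le> M" using that(1) b by (auto simp: I_def)
    ultimately show ?thesis by linarith
  qed
  define f where "f = (\<lambda>t y. u y * mollifier \<delta> (x + t *\<^sub>R b - y))"
  define f' where "f' = (\<lambda>t y. u y * (\<psi>' ((x + t *\<^sub>R b - y) \<bullet> (x + t *\<^sub>R b - y)) * (2 * ((x + t *\<^sub>R b - y) \<bullet> b))))"
  have cont_f: "continuous_on S (f t)" for S t
    unfolding f_def by (intro continuous_intros continuous_on_subset[OF u]) auto
  have cont_f': "continuous_on S (\<lambda>(t, y). f' t y)" for S
  proof -
    have "continuous_on S (\<lambda>z. u (snd z))"
      by (rule continuous_on_compose2[OF u]) (auto intro: continuous_intros)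
    then show ?thesis
      unfolding f'_def \<psi>'_def split_beta divide_inverse by (intro continuous_intros)
  qed
  have cont_f'2: "continuous_on S (f' t)" for S t
    using continuous_on_compose2[OF cont_f'[of UNIV], of S "\<lambda>y. (t, y)"]
    by (simp add: continuous_on_Pair[OF continuous_on_const continuous_on_id])
  have HK: "(LINT y|lborel. g y) = integral (cbox (- c) c) g"
    if "continuous_on UNIV g" "\<And>y. y \<notin> cbox (- c) c \<Longrightarrow> g y = 0" for g :: "'a \<Rightarrow> real"
  proof -
    have "set_integrable lborel (cbox (- c) c) g"
      unfolding set_integrable_def
      by (intro borel_integrable_compact compact_cbox continuous_on_subset[OF that(1)]) simp
    from set_borel_integral_eq_integral(2)[OF this]
    have "(LINT y:cbox (- c) c|lborel. g y) = integral (cbox (- c) c) g" .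
    moreover have "(LINT y:cbox (- c) c|lborel. g y) = (LINT y|lborel. g y)"
      unfolding set_lebesgue_integral_def using that(2)
      by (intro Bochner_Integration.integral_cong) (auto simp: indicator_def)
    ultimately show ?thesis by simp
  qed
  have F: "mollify (mollifier \<delta>) u (x + t *\<^sub>R b) = integral (cbox (- c) c) (f t)" if "t \<in> I" for t
  proof -
    have "mollify (mollifier \<delta>) u (x + t *\<^sub>R b) = (LINT y|lborel. f t y)"
      by (simp add: mollify_def f_def mult.commute)
    also have "\<dots> = integral (cbox (- c) c) (f t)"
      by (rule HK[OF cont_f]) (use out[OF that] in \<open>auto simp: f_def mollifier_eq_0\<close>)
    finally show ?thesis .
  qed
  have F': "mollify (mollifier \<delta>) G (x + t *\<^sub>R b) \<bullet> b = integral (cbox (- c) c) (f' t)" if "t \<in> I" for t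
  proof -
    let ?x = "x + t *\<^sub>R b"
    let ?\<phi> = "\<lambda>y. \<psi> ((y - ?x) \<bullet> (y - ?x))"
    have G1: "Lp_loc 1 UNIV G" using G by (simp add: weak_gradient_def)
    have test: "test_function UNIV ?\<phi>"
      by (rule test_function_radial[OF smooth, of "\<delta>\<^sup>2"]) (simp add: \<psi>_def flat_exp_eq_0)
    have "mollify (mollifier \<delta>) G ?x \<bullet> b = (LINT y|lborel. (G y \<bullet> b) * ?\<phi> y)"
      by (simp add: mollify_mollifier_inner[OF G1] moll)
    also have "\<dots> = - (LINT y|lborel. u y * (grad ?\<phi> y \<bullet> b))"
      using G test b by (simp add: weak_gradient_def set_lebesgue_integral_def)
    also have "\<dots> = (LINT y|lborel. - (u y * (grad ?\<phi> y \<bullet> b)))" by simp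
    also have "\<dots> = (LINT y|lborel. f' t y)"
    proof (intro Bochner_Integration.integral_cong refl)
      fix y
      have "(?x - y) \<bullet> (?x - y) = (y - ?x) \<bullet> (y - ?x)"
        by (rule inner_diff_self_commute)
      moreover have "(?x - y) \<bullet> b = - ((y - ?x) \<bullet> b)"
        by (simp add: inner_diff_left)
      ultimately show "- (u y * (grad ?\<phi> y \<bullet> b)) = f' t y"
        by (simp add: f'_def grad_radial[OF d\<psi>])
    qed
    also have "\<dots> = integral (cbox (- c) c) (f' t)"
      by (rule HK[OF cont_f'2]) (use flat_exp_eq_0[OF inner_self_ge[OF out[OF that]]] in \<open>simp add: f'_def \<psi>'_def\<close>)
    finally show ?thesis .
  qed
  have "((\<lambda>t. integral (cbox (- c) c) (f t)) has_real_derivative integral (cbox (- c) c) (f' t0)) (at t0 within I)"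
  proof (rule leibniz_rule_field_derivative[OF _ _ cont_f' t0 I(1)])
    fix t y
    have "((\<lambda>t. (x + t *\<^sub>R b - y) \<bullet> (x + t *\<^sub>R b - y)) has_real_derivative 2 * ((x + t *\<^sub>R b - y) \<bullet> b)) (at t)"
      unfolding has_field_derivative_def
      by (rule derivative_eq_intros refl)+ (simp add: fun_eq_iff inner_commute)
    from DERIV_cmult[OF DERIV_chain2[OF d\<psi> this], of "u y"]
    have "((\<lambda>t. f t y) has_real_derivative f' t y) (at t)"
      unfolding f_def f'_def moll inner_diff_self_commute[of y] .
    then show "((\<lambda>t. f t y) has_real_derivative f' t y) (at t within I)"
      by (rule has_field_derivative_at_within)
  qed (intro integrable_continuous cont_f)
  then have "((\<lambda>t. integral (cbox (- c) c) (f t)) has_real_derivative integral (cbox (- c) c) (f' t0)) (at t0)"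
    using at_within_open[OF t0 I(2)] by simp
  then show "((\<lambda>t. mollify (mollifier \<delta>) u (x + t *\<^sub>R b)) has_real_derivative
          mollify (mollifier \<delta>) G (x + t0 *\<^sub>R b) \<bullet> b) (at t0)"
    unfolding F'[OF t0] by (rule has_field_derivative_transform_within_open[OF _ I(2) t0]) (simp add: F)
  have "continuous_on I (\<lambda>t. integral (cbox (- c) c) (f' t))"
    by (rule integral_continuous_on_param[OF cont_f'])
  then have "continuous_on I (\<lambda>t. mollify (mollifier \<delta>) G (x + t *\<^sub>R b) \<bullet> b)"
    by (rule continuous_on_eq) (simp add: F')
  then show "isCont (\<lambda>t. mollify (mollifier \<delta>) G (x + t *\<^sub>R b) \<bullet> b) t0"
    using I(2) t0 continuous_on_eq_continuous_at by blast
qed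

end

section \<open>The weak gradient of a radial function is radial\<close>

text \<open>The reflection in the hyperplane orthogonal to \<open>x - y\<close> exchanges \<open>x\<close> and \<open>y\<close>.\<close>

lemma orthogonal_transformation_exists_norm_eq:
  fixes x y :: "'a::euclidean_space"
  assumes "norm x = norm y"
  obtains T where "orthogonal_transformation T" "T x = y"
proof (cases "x = y")
  case True
  then show thesis using that[of "\<lambda>z. z"] orthogonal_transformation_id by auto
next
  case False
  define d where "d = x - y"
  define T where "T = (\<lambda>z. z - (2 * (z \<bullet> d) / (d \<bullet> d)) *\<^sub>R d)"
  have dd: "d \<bullet> d \<noteq> 0" using False by (simp add: d_def)
  have eq: "x \<bullet> x = y \<bullet> y" using assms by (simp add: dot_square_norm)
  have "linear T"
    by (rule linearI) (simp_all add: T_def inner_add_left algebra_simps add_divide_distrib)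
  moreover have "T v \<bullet> T w = v \<bullet> w" for v w
  proof -
    have "T v \<bullet> T w = v \<bullet> w - 2 * (w \<bullet> d) / (d \<bullet> d) * (v \<bullet> d) - 2 * (v \<bullet> d) / (d \<bullet> d) * (w \<bullet> d)
        + 2 * (v \<bullet> d) / (d \<bullet> d) * (2 * (w \<bullet> d) / (d \<bullet> d) * (d \<bullet> d))"
      by (simp add: T_def inner_diff_left inner_diff_right inner_commute[of d w])
    also have "2 * (w \<bullet> d) / (d \<bullet> d) * (d \<bullet> d) = 2 * (w \<bullet> d)"
      using dd by simp
    finally show ?thesis by simp
  qed
  ultimately have "orthogonal_transformation T"
    by (simp add: orthogonal_transformation_def)
  moreover have "T x = y"
  proof -
    have "2 * (x \<bullet> d) = d \<bullet> d" using eq by (simp add: d_def inner_diff inner_commute[of y x])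
    then have "T x = x - d" using dd by (simp add: T_def)
    then show ?thesis by (simp add: d_def)
  qed
  ultimately show thesis by (rule that)
qed

text \<open>The unit vector \<open>e\<^sub>0\<close> fixes a ray on which radial functions are read off as functions of one variable.\<close>

locale radial_W11_loc =
  fixes u :: "'a::euclidean_space \<Rightarrow> real" and G :: "'a \<Rightarrow> 'a" and v :: "real \<Rightarrow> real" and e\<^sub>0 :: 'a
  assumes u_cont: "continuous_on UNIV u"
    and G: "weak_gradient UNIV u G"
    and u_radial: "\<And>x. u x = v (norm x)"
    and e0: "e\<^sub>0 \<in> Basis"
begin

lemma G_L1: "Lp_loc 1 UNIV G"
  using G by (simp add: weak_gradient_def)

lemma u_L1: "Lp_loc 1 UNIV u"
  using G by (simp add: weak_gradient_def)

lemma G_measurable [measurable]: "G \<in> borel_measurable borel"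
  by (rule Lp_loc_measurable[OF G_L1])

lemma u_measurable [measurable]: "u \<in> borel_measurable borel"
  by (rule Lp_loc_measurable[OF u_L1])

abbreviation smoothed_u :: "real \<Rightarrow> 'a \<Rightarrow> real" where
  "smoothed_u \<delta> \<equiv> mollify (mollifier \<delta>) u"

abbreviation smoothed_G :: "real \<Rightarrow> 'a \<Rightarrow> 'a" where
  "smoothed_G \<delta> \<equiv> mollify (mollifier \<delta>) G"

text \<open>The derivative of the mollified profile (\<open>profile_has_derivative\<close>), written through \<open>G\<close>.\<close>

definition profile_deriv :: "real \<Rightarrow> real \<Rightarrow> real" where
  "profile_deriv \<delta> r = smoothed_G \<delta> (r *\<^sub>R e\<^sub>0) \<bullet> e\<^sub>0"

text \<open>Substituting an isometry that maps \<open>x\<close> to \<open>y\<close> changes neither the kernel nor \<open>u\<close>.\<close>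

lemma smoothed_u_radial:
  assumes \<delta>: "0 < \<delta>" and "norm x = norm y"
  shows "smoothed_u \<delta> x = smoothed_u \<delta> y"
proof -
  obtain T where T: "orthogonal_transformation T" "T x = y"
    using orthogonal_transformation_exists_norm_eq[OF assms(2)] .
  have nT: "norm (T z) = norm z" and lin: "linear T" for z
    using T(1) by (auto simp: orthogonal_transformation)
  note mollifier_measurable[OF \<delta>, measurable]
  have [measurable]: "T \<in> borel_measurable borel"
    using lin by (intro borel_measurable_continuous_onI linear_continuous_on)
      (simp add: linear_conv_bounded_linear)
  have "smoothed_u \<delta> y = (LINT z|distr lborel borel T. mollifier \<delta> (y - z) *\<^sub>R u z)"
    by (simp add: mollify_def lborel_orthogonal_invariant[OF T(1)])
  also have "\<dots> = (LINT z|lborel. mollifier \<delta> (y - T z) *\<^sub>R u (T z))"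
    by (rule integral_distr) measurable
  also have "\<dots> = smoothed_u \<delta> x"
  proof -
    have "y - T z = T (x - z)" for z using T(2) lin by (simp add: linear_diff)
    then have "mollifier \<delta> (y - T z) = mollifier \<delta> (x - z)" for z
      by (simp add: mollifier_def dot_square_norm nT)
    then show ?thesis by (simp add: mollify_def u_radial nT)
  qed
  finally show ?thesis by simp
qed

lemma profile_has_derivative:
  assumes "0 < \<delta>"
  shows "((\<lambda>r. smoothed_u \<delta> (r *\<^sub>R e\<^sub>0)) has_real_derivative profile_deriv \<delta> r) (at r)"
  using mollify_has_directional_derivative[OF assms u_cont G e0, of 0 r]
  by (simp add: profile_deriv_def)

lemma isCont_profile_deriv: "0 < \<delta> \<Longrightarrow> isCont (profile_deriv \<delta>) r"
  using isCont_mollify_along_line[OF _ u_cont G e0, of \<delta> r 0]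
  by (simp add: profile_deriv_def[abs_def])

text \<open>The mollified function is its profile composed with the norm, so each of its partial derivatives can be
  computed by the chain rule; on the other hand they are the components of the mollified gradient.\<close>

lemma smoothed_G_radial:
  assumes \<delta>: "0 < \<delta>" and x: "x \<noteq> 0"
  shows "smoothed_G \<delta> x = (profile_deriv \<delta> (norm x) / norm x) *\<^sub>R x"
proof (rule euclidean_eqI)
  fix b :: 'a assume b: "b \<in> Basis"
  have "((\<lambda>t. norm (x + t *\<^sub>R b)) has_real_derivative (x \<bullet> b) / norm x) (at 0)"
  proof -
    have "((\<lambda>t. x + t *\<^sub>R b) has_derivative (\<lambda>h. h *\<^sub>R b)) (at 0)"
      by (auto intro!: derivative_eq_intros)
    from has_derivative_compose[OF this, of norm "\<lambda>h. h \<bullet> sgn x"] has_derivative_norm[OF x]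
    have "((\<lambda>t. norm (x + t *\<^sub>R b)) has_derivative (\<lambda>h. (h *\<^sub>R b) \<bullet> sgn x)) (at 0)"
      by simp
    then show ?thesis
      unfolding has_field_derivative_def
      by (rule has_derivative_eq_rhs) (auto simp: sgn_div_norm divide_inverse mult_ac inner_commute)
  qed
  from DERIV_chain2[of "\<lambda>r. smoothed_u \<delta> (r *\<^sub>R e\<^sub>0)", OF _ this]
  have "((\<lambda>t. smoothed_u \<delta> (norm (x + t *\<^sub>R b) *\<^sub>R e\<^sub>0)) has_real_derivative
      profile_deriv \<delta> (norm x) * ((x \<bullet> b) / norm x)) (at 0)"
    using profile_has_derivative[OF \<delta>] by simp
  moreover have "smoothed_u \<delta> (norm (x + t *\<^sub>R b) *\<^sub>R e\<^sub>0) = smoothed_u \<delta> (x + t *\<^sub>R b)" for t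
    by (rule smoothed_u_radial[OF \<delta>]) (use e0 in simp)
  ultimately have "smoothed_G \<delta> x \<bullet> b = profile_deriv \<delta> (norm x) * ((x \<bullet> b) / norm x)"
    using mollify_has_directional_derivative[OF \<delta> u_cont G b, of x 0] DERIV_unique by fastforce
  then show "smoothed_G \<delta> x \<bullet> b = ((profile_deriv \<delta> (norm x) / norm x) *\<^sub>R x) \<bullet> b"
    by simp
qed

lemma smoothed_u_tendsto:
  assumes \<delta>: "\<delta> \<longlonglongrightarrow> 0" "\<And>k. 0 < \<delta> k"
  shows "(\<lambda>k. smoothed_u (\<delta> k) x) \<longlonglongrightarrow> u x"
proof (rule LIMSEQ_I)
  fix e :: real assume e: "0 < e"
  have "isCont u x" using u_cont continuous_on_eq_continuous_at open_UNIV by blast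
  then obtain d where d: "0 < d" "\<And>y. dist y x < d \<Longrightarrow> dist (u y) (u x) < e / 2"
    unfolding continuous_at_eps_delta using e half_gt_zero by metis
  obtain K where K: "\<And>k. K \<le> k \<Longrightarrow> \<delta> k < d"
    using order_tendstoD(2)[OF \<delta>(1) d(1)] by (auto simp: eventually_sequentially)
  show "\<exists>K. \<forall>k\<ge>K. norm (smoothed_u (\<delta> k) x - u x) < e"
  proof (intro exI allI impI)
    fix k assume k: "K \<le> k"
    let ?\<rho> = "\<lambda>y. mollifier (\<delta> k) (x - y)"
    have int: "integrable lborel (\<lambda>y. ?\<rho> y *\<^sub>R u y)"
      by (rule mollifier_mult_integrable[OF \<delta>(2) u_L1])
    have dl: "distr lborel borel (\<lambda>y. x - y) = lborel" by (rule distr_lborel_reflect)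
    note mollifier_measurable[OF \<delta>(2), measurable]
    have int\<rho>: "integrable lborel ?\<rho>"
      using mollifier_integrable[OF \<delta>(2)] by (intro integrable_distr[of "\<lambda>y. x - y" lborel borel]) (simp_all add: dl)
    have one: "(LINT y|lborel. ?\<rho> y) = 1"
      using integral_distr[of "\<lambda>y. x - y" lborel borel "mollifier (\<delta> k)"] mollifier_integral[OF \<delta>(2), where 'a = 'a]
      by (simp add: dl)
    have "smoothed_u (\<delta> k) x - u x = (LINT y|lborel. ?\<rho> y * (u y - u x))"
      using int int\<rho> one by (simp add: mollify_def right_diff_distrib)
    also have "norm \<dots> \<le> (LINT y|lborel. ?\<rho> y * (e / 2))"
    proof (rule Bochner_Integration.integral_norm_bound_integral)
      fix y
      show "norm (?\<rho> y * (u y - u x)) \<le> ?\<rho> y * (e / 2)"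
      proof (cases "norm (x - y) < \<delta> k")
        case True
        then have "\<bar>u y - u x\<bar> \<le> e / 2"
          using d(2)[of y] K[OF k] by (simp add: dist_norm norm_minus_commute)
        then have "?\<rho> y * \<bar>u y - u x\<bar> \<le> ?\<rho> y * (e / 2)"
          by (rule mult_left_mono[OF _ mollifier_nonneg[OF \<delta>(2)]])
        then show ?thesis
          using mollifier_nonneg[OF \<delta>(2), of k "x - y"] by (simp add: abs_mult)
      next
        case False
        then show ?thesis by (simp add: mollifier_eq_0[OF \<delta>(2)])
      qed
    qed (use int int\<rho> in \<open>auto simp: right_diff_distrib\<close>)
    also have "\<dots> < e" using one e by simp
    finally show "norm (smoothed_u (\<delta> k) x - u x) < e" by simp
  qed
qed

lemma v_eq: "0 \<le> r \<Longrightarrow> v r = u (r *\<^sub>R e\<^sub>0)"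
  using e0 by (simp add: u_radial)

text \<open>On the ball of radius \<open>R\<close> the mollified gradients are classical radial fields with profiles \<open>g k\<close>.
  They converge to \<open>G\<close> in the mean and, along a subsequence, almost everywhere, so \<open>h\<close> can be taken as
  the pointwise limit of the profiles. Convergence in the mean passes to the radial variable, because on
  an interval away from \<open>0\<close> the density of the radial measure is bounded below; this allows the
  fundamental theorem of calculus for the mollified profiles to pass to the limit.\<close>

lemma gradient_radial_profile:
  assumes R: "0 < R"
  obtains h where "h \<in> borel_measurable borel"
    and "AE x in lborel. norm x < R \<longrightarrow> G x = (h (norm x) / norm x) *\<^sub>R x"
    and "\<And>a b. \<lbrakk>0 < a; a \<le> b; b < R\<rbrakk> \<Longrightarrow> set_integrable lborel {a..b} h"
    and "\<And>a b. \<lbrakk>0 < a; a \<le> b; b < R\<rbrakk> \<Longrightarrow> v b - v a = (LINT r:{a..b}|lborel. h r)"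
proof -
  \<comment> \<open>The kernels have radius at most \<open>1\<close>, so cutting \<open>G\<close> off at \<open>R + 1\<close> makes it integrable without
    changing its mollifications on the ball of radius \<open>R\<close>.\<close>
  define H where "H = (\<lambda>x. indicator (ball 0 (R + 1)) x *\<^sub>R G x)"
  have H: "integrable lborel H"
  proof -
    have "set_integrable lborel (ball 0 (R + 1)) G"
      by (rule set_integrable_subset[OF Lp_loc_1_set_integrable[OF G_L1 compact_cball[of 0 "R + 1"]]]) auto
    then show ?thesis by (simp add: H_def set_integrable_def)
  qed
  define \<delta> where "\<delta> = (\<lambda>k::nat. 1 / (real k + 1))"
  have \<delta>: "0 < \<delta> k" "\<delta> k \<le> 1" for k by (auto simp: \<delta>_def)
  have \<delta>_lim: "\<delta> \<longlonglongrightarrow> 0"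
    using LIMSEQ_inverse_real_of_nat by (simp add: \<delta>_def[abs_def] inverse_eq_divide add.commute)
  define E where "E = (\<lambda>k x. mollify (mollifier (\<delta> k)) H x - H x)"
  have E_bound: "(LINT x|lborel. norm (E k x)) \<le> e" if "\<And>t. norm t < \<delta> k \<Longrightarrow> L1_modulus H t \<le> e" for e k
    unfolding E_def
    by (rule mollify_L1_error(2)[OF H mollifier_integrable mollifier_integral mollifier_nonneg mollifier_le mollifier_eq_0 that])
       (use \<delta> in auto)
  have "eventually (\<lambda>k. (\<forall>t. norm t < \<delta> k \<longrightarrow> L1_modulus H t \<le> e)) sequentially" if e: "0 < e" for e
  proof -
    have "\<forall>\<^sub>F t in at 0. L1_modulus H t < e"
      by (rule order_tendstoD(2)[OF L1_modulus_tendsto_zero[OF H] e])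
    then obtain d where d: "0 < d" "\<And>t. t \<noteq> 0 \<Longrightarrow> norm t < d \<Longrightarrow> L1_modulus H t < e"
      by (auto simp: eventually_at)
    have "L1_modulus H 0 = 0" by (simp add: L1_modulus_def)
    with d e have d': "norm t < d \<Longrightarrow> L1_modulus H t \<le> e" for t by (cases "t = 0") (auto intro: less_imp_le)
    show ?thesis
      using order_tendstoD(2)[OF \<delta>_lim d(1)] by eventually_elim (auto intro!: d')
  qed
  note modulus = this
  have E_int: "integrable lborel (E k)" for k
  proof -
    have bnd: "L1_modulus H t \<le> 2 * (LINT x|lborel. norm (H x))" for t
      using L1_modulus_approx[OF H integrable_zero, of t] by (simp add: L1_modulus_def)
    show ?thesis
      unfolding E_def
      by (rule mollify_L1_error(1)[OF H mollifier_integrable mollifier_integral mollifier_nonneg mollifier_le mollifier_eq_0 bnd])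
         (use \<delta> in auto)
  qed
  have E_lim: "(\<lambda>k. LINT x|lborel. norm (E k x)) \<longlonglongrightarrow> 0"
  proof (rule tendstoI)
    fix e :: real assume e: "0 < e"
    show "\<forall>\<^sub>F k in sequentially. dist (LINT x|lborel. norm (E k x)) 0 < e"
      using modulus[of "e / 2"] e
      by (auto elim!: eventually_mono intro!: le_less_trans[OF E_bound[of _ "e / 2"]])
  qed
  obtain \<sigma> where \<sigma>: "strict_mono \<sigma>" and E_AE: "AE x in lborel. (\<lambda>k. E (\<sigma> k) x) \<longlonglongrightarrow> 0"
    using tendsto_L1_AE_subseq[OF E_int E_lim] by blast
  define g where "g = (\<lambda>k. profile_deriv (\<delta> (\<sigma> k)))"
  have isCont_g: "isCont (g k) r" for k r
    unfolding g_def by (rule isCont_profile_deriv[OF \<delta>(1)])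
  have g_measurable [measurable]: "g k \<in> borel_measurable borel" for k
    using isCont_g by (intro borel_measurable_continuous_onI continuous_at_imp_continuous_on) auto
  define h where "h = (\<lambda>r. lim (\<lambda>k. g k r))"
  have h_measurable [measurable]: "h \<in> borel_measurable borel"
    unfolding h_def by (rule borel_measurable_lim_metric) measurable
  have E_eq: "E (\<sigma> k) x = (g k (norm x) / norm x) *\<^sub>R x - G x" if x: "x \<noteq> 0" "norm x < R" for k x
  proof -
    have "mollify (mollifier (\<delta> (\<sigma> k))) H x = smoothed_G (\<delta> (\<sigma> k)) x"
      unfolding mollify_def
    proof (intro Bochner_Integration.integral_cong refl)
      fix y
      show "mollifier (\<delta> (\<sigma> k)) (x - y) *\<^sub>R H y = mollifier (\<delta> (\<sigma> k)) (x - y) *\<^sub>R G y"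
      proof (cases "norm y < R + 1")
        case True
        then show ?thesis by (simp add: H_def)
      next
        case False
        have "norm y \<le> norm x + norm (x - y)"
          by (metis norm_minus_commute norm_triangle_sub)
        with False x(2) \<delta>(2)[of "\<sigma> k"] have "\<delta> (\<sigma> k) \<le> norm (x - y)" by linarith
        then show ?thesis by (simp add: mollifier_eq_0[OF \<delta>(1)])
      qed
    qed
    moreover have "H x = G x" using x(2) by (simp add: H_def)
    ultimately show ?thesis
      using smoothed_G_radial[OF \<delta>(1) x(1), of "\<sigma> k"] by (simp add: E_def g_def)
  qed
  have ne0: "AE x in lborel. (x::'a) \<noteq> 0"
    by (rule AE_lborel_singleton)
  have AE_lim: "AE x in lborel. norm x < R \<longrightarrow> G x = (h (norm x) / norm x) *\<^sub>R x"
    using E_AE ne0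
  proof eventually_elim
    case (elim x)
    show ?case
    proof
      assume xR: "norm x < R"
      have "(\<lambda>k. E (\<sigma> k) x + G x) \<longlonglongrightarrow> 0 + G x"
        by (intro tendsto_intros elim(1))
      then have lim: "(\<lambda>k. (g k (norm x) / norm x) *\<^sub>R x) \<longlonglongrightarrow> G x"
        by (simp add: E_eq[OF elim(2) xR])
      have "(\<lambda>k. ((g k (norm x) / norm x) *\<^sub>R x) \<bullet> (x /\<^sub>R norm x)) \<longlonglongrightarrow> G x \<bullet> (x /\<^sub>R norm x)"
        by (intro tendsto_intros lim)
      moreover have "((g k (norm x) / norm x) *\<^sub>R x) \<bullet> (x /\<^sub>R norm x) = g k (norm x)" for k
        using elim(2) by (simp add: dot_square_norm power2_eq_square field_simps)
      ultimately have gl: "(\<lambda>k. g k (norm x)) \<longlonglongrightarrow> G x \<bullet> (x /\<^sub>R norm x)" by simp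
      then have "h (norm x) = G x \<bullet> (x /\<^sub>R norm x)" unfolding h_def by (rule limI)
      with gl have "(\<lambda>k. (g k (norm x) / norm x) *\<^sub>R x) \<longlonglongrightarrow> (h (norm x) / norm x) *\<^sub>R x"
        using elim(2) by (intro tendsto_intros) auto
      with lim show "G x = (h (norm x) / norm x) *\<^sub>R x"
        using LIMSEQ_unique by blast
    qed
  qed
  let ?N = "DIM('a) - 1" and ?\<omega> = "real DIM('a) * unit_ball_vol DIM('a)"
  have \<omega>: "0 < ?\<omega>" by simp
  have diff_int: "set_integrable lborel {a..b} (\<lambda>r. g k r - h r)"
    and diff_bound: "(LINT r:{a..b}|lborel. norm (g k r - h r)) \<le> (LINT x|lborel. norm (E (\<sigma> k) x)) / (?\<omega> * a ^ ?N)"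
    if ab: "0 < a" "a \<le> b" "b < R" for a b k
  proof -
    define f where "f = (\<lambda>r. indicator {a..b} r * norm (g k r - h r))"
    have [measurable]: "f \<in> borel_measurable borel" unfolding f_def by measurable
    have fE: "AE x::'a in lborel. f (norm x) \<le> norm (E (\<sigma> k) x)"
      using AE_lim ne0
    proof eventually_elim
      case (elim x)
      show ?case
      proof (cases "norm x \<in> {a..b}")
        case True
        then have xR: "norm x < R" using ab by simp
        have "E (\<sigma> k) x = ((g k (norm x) - h (norm x)) / norm x) *\<^sub>R x"
          using elim(1) xR by (simp add: E_eq[OF elim(2) xR] diff_divide_distrib scaleR_diff_left)
        then show ?thesis using elim(2) by (simp add: f_def indicator_def)
      qed (simp add: f_def)
    qed
    have f0: "0 \<le> f r" for r by (simp add: f_def)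
    have f_int: "integrable lborel (\<lambda>x::'a. f (norm x))"
      by (rule Bochner_Integration.integrable_bound[OF integrable_norm[OF E_int[of "\<sigma> k"]]])
         (use fE f0 in \<open>auto elim!: eventually_mono\<close>)
    then have f_int': "set_integrable lborel {0..} (\<lambda>r. r ^ ?N * f r)"
      by (subst (asm) integrable_norm_iff) simp_all
    have low: "a ^ ?N * f r \<le> indicator {0..} r *\<^sub>R (r ^ ?N * f r)" for r
    proof (cases "r \<in> {a..b}")
      case True
      then have "a ^ ?N \<le> r ^ ?N" using ab by (intro power_mono) auto
      then show ?thesis using True ab f0[of r] by (simp add: mult_right_mono)
    qed (simp add: f_def)
    have "integrable lborel (\<lambda>r. a ^ ?N * f r)"
    proof (rule Bochner_Integration.integrable_bound[OF f_int'[unfolded set_integrable_def]])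
      have "norm (a ^ ?N * f r) \<le> norm (indicator {0..} r *\<^sub>R (r ^ ?N * f r))" for r
        using order_trans[OF low[of r] abs_ge_self] f0[of r] ab by (simp add: abs_mult)
      then show "AE r in lborel. norm (a ^ ?N * f r) \<le> norm (indicator {0..} r *\<^sub>R (r ^ ?N * f r))"
        by simp
    qed measurable
    then have f_int'': "integrable lborel f" using ab by simp
    then have "integrable lborel (\<lambda>r. norm (indicator {a..b} r *\<^sub>R (g k r - h r)))"
      by (simp add: f_def abs_mult)
    then show "set_integrable lborel {a..b} (\<lambda>r. g k r - h r)"
      unfolding set_integrable_def by (rule integrable_norm_cancel) measurable
    have "?\<omega> * (a ^ ?N * (LINT r|lborel. f r)) = ?\<omega> * (LINT r|lborel. a ^ ?N * f r)" by simp
    also have "\<dots> \<le> ?\<omega> * (LINT r:{0..}|lborel. r ^ ?N * f r)"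
      unfolding set_lebesgue_integral_def
      using \<omega> f_int'' f_int'[unfolded set_integrable_def] low
      by (intro mult_left_mono integral_mono) auto
    also have "\<dots> = (LINT x|lborel. f (norm (x::'a)))"
      by (rule integral_norm[symmetric]) measurable
    also have "\<dots> \<le> (LINT x|lborel. norm (E (\<sigma> k) x))"
      by (rule integral_mono_AE[OF f_int integrable_norm[OF E_int] fE])
    finally have "(LINT r|lborel. f r) \<le> (LINT x|lborel. norm (E (\<sigma> k) x)) / (?\<omega> * a ^ ?N)"
      using \<omega> ab by (simp add: pos_le_divide_eq mult_ac)
    then show "(LINT r:{a..b}|lborel. norm (g k r - h r)) \<le> (LINT x|lborel. norm (E (\<sigma> k) x)) / (?\<omega> * a ^ ?N)"
      by (simp add: set_lebesgue_integral_def f_def)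
  qed
  have g_int: "set_integrable lborel {a..b} (g k)" for a b k
    by (rule borel_integrable_atLeastAtMost') (use isCont_g in \<open>auto intro: continuous_at_imp_continuous_on\<close>)
  have h_int: "set_integrable lborel {a..b} h" if "0 < a" "a \<le> b" "b < R" for a b
    using set_integral_diff(1)[OF g_int[of a b 0] diff_int[OF that, of 0]] by simp
  have "v b - v a = (LINT r:{a..b}|lborel. h r)" if ab: "0 < a" "a \<le> b" "b < R" for a b
  proof -
    let ?w = "\<lambda>k r. smoothed_u (\<delta> (\<sigma> k)) (r *\<^sub>R e\<^sub>0)"
    have sub: "(\<lambda>k. \<delta> (\<sigma> k)) \<longlonglongrightarrow> 0"
      using LIMSEQ_subseq_LIMSEQ[OF \<delta>_lim \<sigma>] by (simp add: comp_def)
    have w_lim: "(\<lambda>k. ?w k r) \<longlonglongrightarrow> v r" if "0 \<le> r" for r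
      using smoothed_u_tendsto[OF sub \<delta>(1), of "r *\<^sub>R e\<^sub>0"] v_eq[OF that] by simp
    have FTC: "(LINT r:{a..b}|lborel. g k r) = ?w k b - ?w k a" for k
    proof -
      have "(LINT r|lborel. indicator {a..b} r *\<^sub>R g k r) = ?w k b - ?w k a"
      proof (rule integral_FTC_atLeastAtMost[OF ab(2)])
        fix r
        have "(?w k has_real_derivative g k r) (at r)"
          unfolding g_def by (rule profile_has_derivative[OF \<delta>(1)])
        then show "(?w k has_vector_derivative g k r) (at r within {a..b})"
          unfolding has_real_derivative_iff_has_vector_derivative by (rule has_vector_derivative_at_within)
      next
        show "continuous_on {a..b} (g k)"
          by (simp add: continuous_at_imp_continuous_on isCont_g)
      qed
      then show ?thesis by (simp add: set_lebesgue_integral_def)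
    qed
    have "(\<lambda>k. (LINT r:{a..b}|lborel. g k r) - (LINT r:{a..b}|lborel. h r)) \<longlonglongrightarrow> 0"
    proof (rule Lim_null_comparison)
      show "(\<lambda>k. (LINT x|lborel. norm (E (\<sigma> k) x)) / (?\<omega> * a ^ ?N)) \<longlonglongrightarrow> 0"
        using LIMSEQ_subseq_LIMSEQ[OF E_lim \<sigma>] by (intro tendsto_divide_zero) (simp add: comp_def)
      show "\<forall>\<^sub>F k in sequentially. norm ((LINT r:{a..b}|lborel. g k r) - (LINT r:{a..b}|lborel. h r))
          \<le> (LINT x|lborel. norm (E (\<sigma> k) x)) / (?\<omega> * a ^ ?N)"
      proof (rule always_eventually, rule allI)
        fix k
        have "norm ((LINT r:{a..b}|lborel. g k r) - (LINT r:{a..b}|lborel. h r)) = norm (LINT r:{a..b}|lborel. g k r - h r)"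
          by (simp add: set_integral_diff(2)[OF g_int h_int[OF ab]])
        also have "\<dots> \<le> (LINT r:{a..b}|lborel. norm (g k r - h r))"
          by (rule set_integral_norm_bound[OF diff_int[OF ab]])
        also note diff_bound[OF ab, of k]
        finally show "norm ((LINT r:{a..b}|lborel. g k r) - (LINT r:{a..b}|lborel. h r))
          \<le> (LINT x|lborel. norm (E (\<sigma> k) x)) / (?\<omega> * a ^ ?N)" .
      qed
    qed
    then have "(\<lambda>k. ?w k b - ?w k a) \<longlonglongrightarrow> (LINT r:{a..b}|lborel. h r)"
      unfolding FTC by (rule LIM_zero_cancel)
    moreover have "(\<lambda>k. ?w k b - ?w k a) \<longlonglongrightarrow> v b - v a"
      using ab by (intro tendsto_diff w_lim) auto
    ultimately show ?thesis using LIMSEQ_unique by blast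
  qed
  with h_measurable AE_lim h_int show thesis by (rule that)
qed

end

section \<open>The radial ordinary differential equation and its Pohozaev function\<close>

text \<open>A function that increases on \<open>(0, r]\<close> is nonnegative at \<open>r\<close> if near \<open>0\<close> it is bounded below by a
  function tending to \<open>0\<close>; it need not have a limit at \<open>0\<close> itself.\<close>

lemma nonneg_of_deriv_nonneg_from_zero:
  fixes f f' g :: "real \<Rightarrow> real"
  assumes "0 < r"
    and deriv: "\<And>s. \<lbrakk>0 < s; s \<le> r\<rbrakk> \<Longrightarrow> (f has_real_derivative f' s) (at s)"
    and nonneg: "\<And>s. \<lbrakk>0 < s; s \<le> r\<rbrakk> \<Longrightarrow> 0 \<le> f' s"
    and bound: "\<And>s. \<lbrakk>0 < s; s \<le> r\<rbrakk> \<Longrightarrow> g s \<le> f s"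
    and lim: "(g \<longlongrightarrow> 0) (at_right 0)"
  shows "0 \<le> f r"
proof (rule tendsto_upperbound[OF lim])
  show "\<forall>\<^sub>F s in at_right 0. g s \<le> f r"
    unfolding eventually_at_right_field
  proof (intro exI[of _ r] conjI allI impI)
    fix s assume s: "0 < s" "s < r"
    have "f s \<le> f r"
    proof (rule DERIV_nonneg_imp_nondecreasing[of s r f])
      fix x assume "s \<le> x" "x \<le> r"
      with s show "\<exists>y. (f has_real_derivative y) (at x) \<and> 0 \<le> y"
        by (intro exI[of _ "f' x"] conjI deriv nonneg) auto
    qed (use s in simp)
    with bound[of s] s show "g s \<le> f r" by simp
  qed fact
qed simp

lemma powr_tendsto_zero_at_right:
  fixes a :: real assumes "0 < a"
  shows "((\<lambda>s. s powr a) \<longlongrightarrow> 0) (at_right 0)"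
proof -
  have "((\<lambda>s::real. s powr a) \<longlongrightarrow> 0 powr a) (at_right 0)"
    by (rule tendsto_powr2) (use assms in \<open>auto simp: eventually_at_right_field intro!: tendsto_eq_intros exI[of _ 1]\<close>)
  then show ?thesis by simp
qed

text \<open>The real number \<open>n\<close> plays the part of the dimension. The first-order system states that
  \<open>r powr (n - 1) * \<bar>v' r\<bar> powr (p - 1)\<close> equals \<open>F r\<close> with \<open>v'\<close> nonpositive.\<close>

locale radial_ode =
  fixes p q n a :: real and v F :: "real \<Rightarrow> real"
  assumes p1: "1 < p" and pn: "p < n" and pq: "p - 1 < q"
    and subcritical: "(q + 1) * (n - p) < p * (n + a)"
    and v_pos: "\<And>r. 0 < r \<Longrightarrow> 0 < v r"
    and v_bounded: "\<exists>B. \<forall>r. 0 < r \<longrightarrow> r \<le> 1 \<longrightarrow> v r \<le> B"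
    and F_lim: "(F \<longlongrightarrow> 0) (at_right 0)"
    and F_deriv: "\<And>r. 0 < r \<Longrightarrow>
          (F has_real_derivative r powr (n - 1 + a) * v r powr q) (at r)"
    and v_deriv: "\<And>r. 0 < r \<Longrightarrow>
          (v has_real_derivative - ((F r * r powr (1 - n)) powr (1 / (p - 1)))) (at r)"
begin

lemma q_pos: "0 < q"
  using p1 pq by simp

lemma a_gt: "0 < p + a"
proof -
  have "p * (n - p) < (q + 1) * (n - p)"
    using pq pn by (intro mult_strict_right_mono) auto
  with subcritical have "p * (n - p) < p * (n + a)" by simp
  then have "n - p < n + a" using p1 by simp
  then show ?thesis by simp
qed

lemma na_pos: "0 < n + a"
  using a_gt pn by simp

lemma v_antimono:
  assumes "0 < s" "s \<le> r"
  shows "v r \<le> v s"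
proof (rule DERIV_nonpos_imp_nonincreasing[of s r v])
  fix x assume "s \<le> x" "x \<le> r"
  with assms(1) show "\<exists>y. (v has_real_derivative y) (at x) \<and> y \<le> 0"
    by (intro exI[of _ "- ((F x * x powr (1 - n)) powr (1 / (p - 1)))"] conjI v_deriv) auto
qed (use assms in simp)

text \<open>As \<open>v\<close> decreases, \<open>F'\<close> on \<open>(0, r]\<close> is at least \<open>s powr (n - 1 + a) * v r powr q\<close>.\<close>

lemma F_lower:
  assumes r: "0 < r"
  shows "v r powr q * r powr (n + a) / (n + a) \<le> F r"
proof -
  define c where "c = v r powr q / (n + a)"
  have c: "0 \<le> c" using na_pos by (simp add: c_def)
  have FnonnegD: "0 \<le> F s" if "0 < s" for s
    by (rule nonneg_of_deriv_nonneg_from_zero[OF that, where f = F and g = F])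
       (use F_deriv F_lim in auto)
  have "0 \<le> F r - c * r powr (n + a)"
  proof (rule nonneg_of_deriv_nonneg_from_zero[OF r, where f = "\<lambda>s. F s - c * s powr (n + a)"])
    fix s assume s: "0 < s" "s \<le> r"
    show "((\<lambda>s. F s - c * s powr (n + a)) has_real_derivative
        s powr (n - 1 + a) * v s powr q - c * ((n + a) * s powr (n + a - 1))) (at s)"
      by (rule derivative_eq_intros F_deriv refl s)+ (use s in auto)
    have "s powr (n + a - 1) * v r powr q \<le> s powr (n - 1 + a) * v s powr q"
      using v_antimono[OF s] v_pos[OF r] q_pos s 
      by (auto simp: algebra_simps intro!: mult_left_mono powr_mono2)
    then show "0 \<le> s powr (n - 1 + a) * v s powr q - c * ((n + a) * s powr (n + a - 1))"
      using na_pos by (simp add: c_def mult_ac)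
    show "- c * s powr (n + a) \<le> F s - c * s powr (n + a)"
      using FnonnegD[OF s(1)] by simp
  next
    show "((\<lambda>s. - c * s powr (n + a)) \<longlongrightarrow> 0) (at_right 0)"
      using tendsto_mult[OF tendsto_const powr_tendsto_zero_at_right[OF na_pos], of "-c"] by simp
  qed
  then show ?thesis by (simp add: c_def)
qed

lemma F_pos: assumes "0 < r" shows "0 < F r"
  by (rule less_le_trans[OF _ F_lower[OF assms]])
     (use assms v_pos[OF assms] na_pos in \<open>auto intro!: divide_pos_pos mult_pos_pos\<close>)

text \<open>With \<open>F_lower\<close> the equation gives \<open>- v' \<ge> c * v powr (q / (p - 1)) * r powr ((1 + a) / (p - 1))\<close>. Since
  \<open>q > p - 1\<close>, this is a lower bound for the derivative of a negative power of \<open>v\<close>, and integration from \<open>0\<close>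
  makes that power large.\<close>

lemma v_decay:
  obtains K where "0 < K" "\<And>r. 0 < r \<Longrightarrow> v r \<le> K * r powr (- ((p + a) / (q - p + 1)))"
proof -
  define \<sigma> where "\<sigma> = (q - p + 1) / (p - 1)"
  define \<theta> where "\<theta> = (p + a) / (p - 1)"
  define V where "V = (\<lambda>r. (F r * r powr (1 - n)) powr (1 / (p - 1)))"
  define c where "c = (1 / (n + a)) powr (1 / (p - 1))"
  define k where "k = \<sigma> * c / \<theta>"
  have pos: "0 < \<sigma>" "0 < \<theta>" "0 < c" "0 < k"
    using p1 pq a_gt na_pos by (auto simp: \<sigma>_def \<theta>_def c_def k_def)
  have V: "c * v r powr (q / (p - 1)) * r powr (\<theta> - 1) \<le> V r" if r: "0 < r" for r
  proof -
    have "c * v r powr (q / (p - 1)) * r powr (\<theta> - 1)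
        = (v r powr q * r powr (n + a) / (n + a) * r powr (1 - n)) powr (1 / (p - 1))"
    proof -
      have e: "\<theta> - 1 = (1 + a) / (p - 1)" using p1 by (simp add: \<theta>_def field_simps)
      have eq: "v r powr q * r powr (n + a) / (n + a) * r powr (1 - n)
          = (1 / (n + a)) * (v r powr q * r powr (1 + a))"
        by (simp add: powr_add[symmetric] add.commute)
      show ?thesis
        unfolding eq using na_pos v_pos[OF r] r p1 by (simp add: powr_mult powr_powr powr_divide e c_def)
    qed
    also have "\<dots> \<le> V r"
      unfolding V_def using F_lower[OF r] p1 na_pos r
      by (intro powr_mono2 mult_right_mono) (auto intro!: mult_nonneg_nonneg divide_nonneg_pos)
    finally show ?thesis .
  qed
  have main: "k * r powr \<theta> \<le> v r powr (- \<sigma>)" if r: "0 < r" for r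
  proof -
    have "0 \<le> v r powr (- \<sigma>) - k * r powr \<theta>"
    proof (rule nonneg_of_deriv_nonneg_from_zero[OF r, where f = "\<lambda>r. v r powr (- \<sigma>) - k * r powr \<theta>"])
      fix s assume s: "0 < s" "s \<le> r"
      note vs = v_pos[OF s(1)]
      have dv: "(v has_real_derivative - V s) (at s)"
        using v_deriv[OF s(1)] by (simp add: V_def)
      show "((\<lambda>s. v s powr (- \<sigma>) - k * s powr \<theta>) has_real_derivative
         \<sigma> * v s powr (- \<sigma> - 1) * V s - k * \<theta> * s powr (\<theta> - 1)) (at s)"
        by (rule derivative_eq_intros dv refl s vs)+ (use vs s in auto)
      have "k * \<theta> * s powr (\<theta> - 1) = \<sigma> * (c * s powr (\<theta> - 1))"
        using pos by (simp add: k_def)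
      also have "\<dots> = \<sigma> * v s powr (- \<sigma> - 1) * (c * v s powr (q / (p - 1)) * s powr (\<theta> - 1))"
      proof -
        have "- \<sigma> - 1 + q / (p - 1) = 0" using p1 by (simp add: \<sigma>_def field_simps)
        then have "v s powr (- \<sigma> - 1) * v s powr (q / (p - 1)) = 1"
          using vs by (simp add: powr_add[symmetric])
        then show ?thesis by (simp add: mult_ac)
      qed
      also have "\<dots> \<le> \<sigma> * v s powr (- \<sigma> - 1) * V s"
        using V[OF s(1)] pos by (intro mult_left_mono) auto
      finally show "0 \<le> \<sigma> * v s powr (- \<sigma> - 1) * V s - k * \<theta> * s powr (\<theta> - 1)" by simp
      show "- k * s powr \<theta> \<le> v s powr (- \<sigma>) - k * s powr \<theta>" by simp
    next
      show "((\<lambda>s. - k * s powr \<theta>) \<longlongrightarrow> 0) (at_right 0)"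
        using tendsto_mult[OF tendsto_const powr_tendsto_zero_at_right[OF pos(2)], of "-k"] by simp
    qed
    then show ?thesis by simp
  qed
  show thesis
  proof (rule that[of "k powr (- 1 / \<sigma>)"])
    show "0 < k powr (- 1 / \<sigma>)" using pos by simp
    fix r :: real assume r: "0 < r"
    have "v r = (v r powr (- \<sigma>)) powr (- 1 / \<sigma>)"
      using v_pos[OF r] pos by (simp add: powr_powr)
    also have "\<dots> \<le> (k * r powr \<theta>) powr (- 1 / \<sigma>)"
      using main[OF r] pos r by (intro powr_mono2') auto
    also have "\<dots> = k powr (- 1 / \<sigma>) * r powr (- ((p + a) / (q - p + 1)))"
    proof -
      have "\<theta> * (- 1 / \<sigma>) = - ((p + a) / (q - p + 1))"
      proof -
        have "\<theta> = (p + a) / (q - p + 1) * \<sigma>" using p1 pq by (simp add: \<theta>_def \<sigma>_def)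
        then show ?thesis using pos by simp
      qed
      then show ?thesis using pos r by (simp add: powr_mult powr_powr)
    qed
    finally show "v r \<le> k powr (- 1 / \<sigma>) * r powr (- ((p + a) / (q - p + 1)))" .
  qed
qed

text \<open>Integrating the decay of \<open>v\<close> gives \<open>F\<close> the exponent \<open>e0\<close>, which may be zero or negative; it is
  replaced by a slightly larger positive exponent \<open>e\<close>. Subcriticality is equivalent to \<open>p * e0 < n - p\<close> and so
  leaves room for \<open>e\<close>.\<close>

lemma F_growth:
  obtains e C where "0 < e" "e * p < n - p" "0 < C" "\<And>r. 1 \<le> r \<Longrightarrow> F r \<le> C * r powr e"
proof -
  obtain K where K: "0 < K" "\<And>r. 0 < r \<Longrightarrow> v r \<le> K * r powr (- ((p + a) / (q - p + 1)))"
    using v_decay by metis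
  define d where "d = q - p + 1"
  define e0 where "e0 = n + a - q * ((p + a) / d)"
  have d: "0 < d" using pq by (simp add: d_def)
  have "p * e0 < n - p"
  proof -
    have "d * (p * e0) = p * (n + a) * d - p * q * (p + a)"
      using d by (simp add: e0_def field_simps)
    also have "\<dots> - d * (n - p) = (p - 1) * ((n - p) * (q + 1) - p * (n + a))"
      by (simp add: d_def algebra_simps)
    also have "\<dots> < 0"
      using p1 subcritical by (intro mult_pos_neg) (auto simp: mult.commute)
    finally have "d * (p * e0) < d * (n - p)" by simp
    then show ?thesis using d by simp
  qed
  then have "max e0 0 < (n - p) / p"
    using p1 pn by (auto simp: field_simps)
  then obtain e where e: "max e0 0 < e" "e < (n - p) / p" using dense by blast
  then have e0: "e0 < e" "0 < e" "e * p < n - p" using p1 by (auto simp: field_simps)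
  define C where "C = F 1 + K powr q / e"
  have Kq: "0 < K powr q / e" using K e0 by simp
  show thesis
  proof (rule that[of e C])
    show "0 < C" using F_pos[of 1] Kq by (simp add: C_def)
    fix r :: real assume r: "1 \<le> r"
    let ?D = "\<lambda>s. F s - K powr q / e * s powr e"
    have "?D r \<le> ?D 1"
    proof (rule DERIV_nonpos_imp_nonincreasing[OF r, where f = ?D])
      fix s :: real assume s: "1 \<le> s" "s \<le> r"
      then have s0: "0 < s" by simp
      have "(?D has_real_derivative s powr (n - 1 + a) * v s powr q - K powr q / e * (e * s powr (e - 1))) (at s)"
        by (rule derivative_eq_intros F_deriv refl s0)+ (use s0 in auto)
      moreover have "s powr (n - 1 + a) * v s powr q \<le> K powr q / e * (e * s powr (e - 1))"
      proof -
        have "s powr (n - 1 + a) * v s powr q \<le> s powr (n - 1 + a) * (K * s powr (- ((p + a) / d))) powr q"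
          using K(2)[OF s0] v_pos[OF s0] q_pos unfolding d_def
          by (intro mult_left_mono powr_mono2) auto
        also have "\<dots> = K powr q * s powr (e0 - 1)"
        proof -
          have "n - 1 + a + - ((p + a) / d) * q = e0 - 1" by (simp add: e0_def mult.commute)
          then have eq: "s powr (e0 - 1) = s powr (n - 1 + a) * s powr (- ((p + a) / d) * q)"
            by (simp only: powr_add[symmetric])
          show ?thesis unfolding eq using K s0
            by (simp add: powr_mult powr_powr mult.left_commute)
        qed
        also have "\<dots> \<le> K powr q * s powr (e - 1)"
          using s e0 by (intro mult_left_mono powr_mono) auto
        finally show ?thesis using e0 by simp
      qed
      ultimately show "\<exists>y. (?D has_real_derivative y) (at s) \<and> y \<le> 0"
        by (intro exI conjI) auto
    qed
    then have "F r \<le> F 1 * 1 + K powr q / e * r powr e" using Kq by simp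
    also have "\<dots> \<le> F 1 * r powr e + K powr q / e * r powr e"
      using ge_one_powr_ge_zero[OF r, of e] e0 F_pos[of 1] by (intro add_mono mult_left_mono) auto
    finally show "F r \<le> C * r powr e" by (simp add: C_def algebra_simps)
  qed (use e0 in auto)
qed

text \<open>The first term is \<open>(p - 1) / p * r powr n * \<bar>v' r\<bar> powr p\<close>, expressed through \<open>F\<close>, whose
  derivative is given. The weight \<open>(n - p) / p\<close> of the last term is the
  one for which the terms with \<open>v' * F\<close> cancel in the derivative.\<close>

definition pohozaev :: "real \<Rightarrow> real" where
  "pohozaev r = (p - 1) / p * r powr (- ((n - p) / (p - 1))) * F r powr (p / (p - 1))
     + r powr (n + a) * v r powr (q + 1) / (q + 1) - (n - p) / p * (v r * F r)"

lemma pohozaev_deriv: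
  assumes r: "0 < r"
  shows "(pohozaev has_real_derivative
           ((n + a) / (q + 1) - (n - p) / p) * r powr (n + a - 1) * v r powr (q + 1)) (at r)"
proof -
  define V where "V = (F r * r powr (1 - n)) powr (1 / (p - 1))"
  define f where "f = r powr (n - 1 + a) * v r powr q"
  define \<beta> where "\<beta> = (n - p) / (p - 1)"
  have V_eq: "V = F r powr (1 / (p - 1)) * r powr (- ((n - 1) / (p - 1)))"
    using F_pos[OF r] r unfolding V_def by (simp add: powr_mult powr_powr minus_divide_left)
  have \<beta>1: "- ((n - 1) / (p - 1)) = - \<beta> - 1" using p1 by (simp add: \<beta>_def field_simps)
  have p': "p / (p - 1) = 1 + 1 / (p - 1)" using p1 by (simp add: field_simps)
  have dv: "(v has_real_derivative - V) (at r)" using v_deriv[OF r] by (simp add: V_def)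
  have dF: "(F has_real_derivative f) (at r)" using F_deriv[OF r] by (simp add: f_def)
  note vr = v_pos[OF r] note Fr = F_pos[OF r]
  have d1: "((\<lambda>r. (p - 1) / p * r powr (- \<beta>) * F r powr (p / (p - 1))) has_real_derivative
      (p - 1) / p * (- \<beta> * r powr (- \<beta> - 1)) * F r powr (p / (p - 1))
       + (p - 1) / p * r powr (- \<beta>) * (p / (p - 1) * F r powr (p / (p - 1) - 1) * f)) (at r)"
    by (rule derivative_eq_intros dF refl r Fr)+ (use r in simp)
  have d2: "((\<lambda>r. r powr (n + a) * v r powr (q + 1) / (q + 1)) has_real_derivative
      ((n + a) * r powr (n + a - 1) * v r powr (q + 1)
       + r powr (n + a) * ((q + 1) * v r powr q * - V)) / (q + 1)) (at r)"
    by (rule derivative_eq_intros dv refl r vr)+ (use r q_pos in simp_all)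
  have d3: "((\<lambda>r. (n - p) / p * (v r * F r)) has_real_derivative
      (n - p) / p * (- V * F r + v r * f)) (at r)"
    by (rule derivative_eq_intros dv dF refl)+ simp
  have "(pohozaev has_real_derivative
      ((p - 1) / p * (- \<beta> * r powr (- \<beta> - 1)) * F r powr (p / (p - 1))
       + (p - 1) / p * r powr (- \<beta>) * (p / (p - 1) * F r powr (p / (p - 1) - 1) * f))
     + ((n + a) * r powr (n + a - 1) * v r powr (q + 1)
       + r powr (n + a) * ((q + 1) * v r powr q * - V)) / (q + 1)
     - (n - p) / p * (- V * F r + v r * f)) (at r)"
    unfolding pohozaev_def[abs_def] \<beta>_def[symmetric]
    by (rule DERIV_diff[OF DERIV_add[OF d1 d2] d3])
  moreover have "(p - 1) / p * (- \<beta> * r powr (- \<beta> - 1)) * F r powr (p / (p - 1)) = - (n - p) / p * (V * F r)"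
  proof -
    have "r powr (- \<beta> - 1) * F r powr (p / (p - 1)) = V * F r"
      using Fr unfolding V_eq p' \<beta>1 by (simp add: powr_add)
    moreover have "(p - 1) / p * - \<beta> = - (n - p) / p" using p1 by (simp add: \<beta>_def field_simps)
    ultimately show ?thesis by (metis mult.assoc)
  qed
  moreover have "(p - 1) / p * r powr (- \<beta>) * (p / (p - 1) * F r powr (p / (p - 1) - 1) * f) = r powr (n + a) * v r powr q * V"
  proof -
    have "r powr (- \<beta>) * F r powr (p / (p - 1) - 1) = r * V"
      using r unfolding V_eq p' \<beta>1 by (simp add: powr_diff)
    moreover have "r * f = r powr (n + a) * v r powr q"
      using r by (simp add: f_def powr_add powr_diff)
    moreover have "(p - 1) / p * (p / (p - 1)) = 1" using p1 by simp
    moreover have "(p - 1) / p * r powr (- \<beta>) * (p / (p - 1) * F r powr (p / (p - 1) - 1) * f)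
        = ((p - 1) / p * (p / (p - 1))) * (r powr (- \<beta>) * F r powr (p / (p - 1) - 1)) * f"
      by (simp only: mult_ac)
    ultimately show ?thesis by (simp add: mult_ac)
  qed
  moreover have "v r * f = r powr (n + a - 1) * v r powr (q + 1)"
    using vr by (simp add: f_def powr_add algebra_simps)
  moreover have "((n + a) * r powr (n + a - 1) * v r powr (q + 1)
       + r powr (n + a) * ((q + 1) * v r powr q * - V)) / (q + 1)
     = (n + a) / (q + 1) * r powr (n + a - 1) * v r powr (q + 1) - r powr (n + a) * v r powr q * V"
    using q_pos by (simp add: field_simps)
  moreover have "- (n - p) / p * (V * F r) + r powr (n + a) * v r powr q * V
     + ((n + a) / (q + 1) * r powr (n + a - 1) * v r powr (q + 1) - r powr (n + a) * v r powr q * V)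
     - (n - p) / p * (- V * F r + r powr (n + a - 1) * v r powr (q + 1))
     = ((n + a) / (q + 1) - (n - p) / p) * r powr (n + a - 1) * v r powr (q + 1)"
    by (simp only: left_diff_distrib right_diff_distrib distrib_left mult.assoc)
  ultimately show ?thesis
    by (simp only:)
qed

lemma pohozaev_coeff_pos: "0 < (n + a) / (q + 1) - (n - p) / p"
proof -
  have "(n + a) / (q + 1) - (n - p) / p = (p * (n + a) - (q + 1) * (n - p)) / (p * (q + 1))"
    using p1 q_pos by (simp add: field_simps)
  then show ?thesis using subcritical p1 q_pos by simp
qed

lemma pohozaev_deriv_pos:
  assumes "0 < r"
  shows "\<exists>y. (pohozaev has_real_derivative y) (at r) \<and> 0 < y"
  using pohozaev_deriv[OF assms] pohozaev_coeff_pos assms v_pos[OF assms]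
  by (intro exI conjI) (assumption, auto intro!: mult_pos_pos)

text \<open>Near \<open>0\<close> only the last term is negative, and it tends to \<open>0\<close> because \<open>v\<close> is bounded and \<open>F\<close>
  vanishes there.\<close>

lemma pohozaev_nonneg:
  assumes r: "0 < r" "r \<le> 1"
  shows "0 \<le> pohozaev r"
proof -
  obtain B where B: "\<And>s. 0 < s \<Longrightarrow> s \<le> 1 \<Longrightarrow> v s \<le> B" using v_bounded by blast
  let ?c = "(n - p) / p * B"
  show ?thesis
  proof (rule nonneg_of_deriv_nonneg_from_zero[OF r(1), where f = pohozaev])
    fix s assume s: "0 < s" "s \<le> r"
    show "(pohozaev has_real_derivative
       ((n + a) / (q + 1) - (n - p) / p) * s powr (n + a - 1) * v s powr (q + 1)) (at s)"
      by (rule pohozaev_deriv[OF s(1)])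
    show "0 \<le> ((n + a) / (q + 1) - (n - p) / p) * s powr (n + a - 1) * v s powr (q + 1)"
      using pohozaev_coeff_pos by simp
    have *: "(n - p) / p * (v s * F s) \<le> (n - p) / p * (B * F s)"
      using B[of s] s r F_pos[OF s(1)] p1 pn by (intro mult_left_mono mult_right_mono) auto
    show "- ?c * F s \<le> pohozaev s"
    proof -
      have "0 \<le> (p - 1) / p * s powr (- ((n - p) / (p - 1))) * F s powr (p / (p - 1))
          + s powr (n + a) * v s powr (q + 1) / (q + 1)"
        using p1 q_pos by simp
      with * show ?thesis unfolding pohozaev_def by (simp only: mult.assoc minus_mult_left[symmetric])
    qed
  next
    show "((\<lambda>s. - ?c * F s) \<longlongrightarrow> 0) (at_right 0)"
      using tendsto_mult[OF tendsto_const F_lim, of "- ?c"] by simp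
  qed
qed

text \<open>The term that contains \<open>v * F\<close> is subtracted, so only the two other terms have to be estimated; the decay
  of \<open>v\<close> and the growth of \<open>F\<close> give both of them negative exponents.\<close>

lemma pohozaev_upper_tendsto_zero:
  obtains g where "\<And>r. 1 \<le> r \<Longrightarrow> pohozaev r \<le> g r" "(g \<longlongrightarrow> 0) at_top"
proof -
  obtain K where K: "0 < K" "\<And>r. 0 < r \<Longrightarrow> v r \<le> K * r powr (- ((p + a) / (q - p + 1)))"
    using v_decay by metis
  obtain e C where e: "0 < e" "e * p < n - p" "0 < C" and FC: "\<And>r. 1 \<le> r \<Longrightarrow> F r \<le> C * r powr e"
    using F_growth by metis
  define p' where "p' = p / (p - 1)"
  define \<beta> where "\<beta> = (n - p) / (p - 1)"
  define \<tau> where "\<tau> = (p + a) / (q - p + 1)"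
  have p': "0 < p'" using p1 by (simp add: p'_def)
  have e1: "- \<beta> + e * p' < 0"
    using e p1 by (simp add: \<beta>_def p'_def divide_strict_right_mono)
  have e2: "n + a - \<tau> * (q + 1) < 0"
  proof -
    have d: "0 < q - p + 1" using pq by simp
    have "(n + a - \<tau> * (q + 1)) * (q - p + 1) = (n + a) * (q - p + 1) - (p + a) * (q + 1)"
      using d by (simp add: \<tau>_def field_simps)
    also have "\<dots> = (q + 1) * (n - p) - p * (n + a)" by (simp add: algebra_simps)
    also have "\<dots> < 0" using subcritical by simp
    finally show ?thesis using d by (simp add: mult_less_0_iff)
  qed
  let ?g = "\<lambda>r. (p - 1) / p * C powr p' * r powr (- \<beta> + e * p')
      + K powr (q + 1) / (q + 1) * r powr (n + a - \<tau> * (q + 1))"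
  show thesis
  proof (rule that[of ?g])
    have "((\<lambda>r::real. r powr x) \<longlongrightarrow> 0) at_top" if "x < 0" for x
      using tendsto_neg_powr[OF that filterlim_ident] .
    from tendsto_add[OF tendsto_mult[OF tendsto_const this[OF e1]] tendsto_mult[OF tendsto_const this[OF e2]]]
    show "(?g \<longlongrightarrow> 0) at_top"
      unfolding mult_zero_right add_0_right .
    fix r :: real assume r: "1 \<le> r"
    then have r0: "0 < r" by simp
    have "(p - 1) / p * r powr (- \<beta>) * F r powr p' \<le> (p - 1) / p * r powr (- \<beta>) * (C * r powr e) powr p'"
      using FC[OF r] F_pos[OF r0] p' p1 by (intro mult_left_mono powr_mono2) auto
    also have "\<dots> = (p - 1) / p * C powr p' * r powr (- \<beta> + e * p')"
    proof -
      have "(C * r powr e) powr p' = C powr p' * r powr (e * p')"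
        using e r0 by (simp add: powr_mult powr_powr)
      then show ?thesis by (simp only: powr_add mult_ac)
    qed
    finally have 1: "(p - 1) / p * r powr (- \<beta>) * F r powr p' \<le> (p - 1) / p * C powr p' * r powr (- \<beta> + e * p')" .
    have "r powr (n + a) * v r powr (q + 1) / (q + 1) \<le> r powr (n + a) * (K * r powr (- \<tau>)) powr (q + 1) / (q + 1)"
      using K(2)[OF r0] v_pos[OF r0] q_pos unfolding \<tau>_def
      by (intro mult_left_mono powr_mono2 divide_right_mono) auto
    also have "\<dots> = K powr (q + 1) / (q + 1) * r powr (n + a - \<tau> * (q + 1))"
    proof -
      have "(K * r powr (- \<tau>)) powr (q + 1) = K powr (q + 1) * r powr (- (\<tau> * (q + 1)))"
        using K r0 by (simp add: powr_mult powr_powr)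
      moreover have "r powr (n + a - \<tau> * (q + 1)) = r powr (n + a) * r powr (- (\<tau> * (q + 1)))"
        by (simp only: powr_add[symmetric]) simp
      ultimately show ?thesis by simp
    qed
    finally have 2: "r powr (n + a) * v r powr (q + 1) / (q + 1) \<le> K powr (q + 1) / (q + 1) * r powr (n + a - \<tau> * (q + 1))" .
    have 3: "0 \<le> (n - p) / p * (v r * F r)"
      using v_pos[OF r0] F_pos[OF r0] p1 pn by simp
    show "pohozaev r \<le> ?g r"
      using 1 2 3 unfolding pohozaev_def \<beta>_def p'_def by linarith
  qed
qed

lemma no_entire_solution: False
proof -
  obtain g where g: "\<And>r. 1 \<le> r \<Longrightarrow> pohozaev r \<le> g r" "(g \<longlongrightarrow> 0) at_top"
    using pohozaev_upper_tendsto_zero by metis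
  have "0 \<le> pohozaev (1 / 2)" by (rule pohozaev_nonneg) auto
  also have "\<dots> < pohozaev 1"
    by (rule DERIV_pos_imp_increasing[where f = pohozaev]) (auto intro!: pohozaev_deriv_pos)
  finally have pos: "0 < pohozaev 1" .
  have mono: "pohozaev 1 \<le> pohozaev r" if "1 \<le> r" for r
    by (rule DERIV_nonneg_imp_nondecreasing[OF that, where f = pohozaev])
       (meson pohozaev_deriv_pos less_imp_le less_le_trans zero_less_one)
  have "pohozaev 1 \<le> 0"
  proof (rule tendsto_lowerbound[OF g(2)])
    show "\<forall>\<^sub>F r in at_top. pohozaev 1 \<le> g r"
      using eventually_ge_at_top[of 1] by eventually_elim (use g mono in force)
  qed simp
  with pos show False by simp
qed

end

section \<open>From the weak equation to the radial equation\<close>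

lemma antiderivative_on_line:
  fixes \<eta> :: "real \<Rightarrow> real"
  assumes cont: "continuous_on UNIV \<eta>"
  obtains \<Phi> where "\<And>t. (\<Phi> has_real_derivative \<eta> t) (at t)"
proof
  \<comment> \<open>One of the two integrals is over an empty or degenerate interval, according to the sign of \<open>t\<close>.\<close>
  let ?\<Phi> = "\<lambda>t. integral {0..t} \<eta> - integral {t..0} \<eta>"
  fix t :: real
  define c where "c = min t 0 - 1"
  have int: "\<eta> integrable_on {a..b}" for a b
    by (rule integrable_continuous_real[OF continuous_on_subset[OF cont]]) simp
  have eq: "integral {c..s} \<eta> - integral {c..0} \<eta> = ?\<Phi> s" if "c < s" for s
  proof (cases "0 \<le> s")
    case True
    then have "integral {c..0} \<eta> + integral {0..s} \<eta> = integral {c..s} \<eta>"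
      by (intro Henstock_Kurzweil_Integration.integral_combine int) (auto simp: c_def)
    moreover have "integral {s..0} \<eta> = 0" using True by (cases "s = 0") auto
    ultimately show ?thesis by simp
  next
    case False
    then have "integral {c..s} \<eta> + integral {s..0} \<eta> = integral {c..0} \<eta>"
      using that by (intro Henstock_Kurzweil_Integration.integral_combine int) auto
    then show ?thesis using False by simp
  qed
  have "((\<lambda>s. integral {c..s} \<eta>) has_real_derivative \<eta> t) (at t within {c..t + 1})"
    by (rule integral_has_real_derivative[OF continuous_on_subset[OF cont]]) (auto simp: c_def)
  then have "((\<lambda>s. integral {c..s} \<eta>) has_real_derivative \<eta> t) (at t)"
    by (simp add: at_within_Icc_at c_def)
  then have "((\<lambda>s. integral {c..s} \<eta> - integral {c..0} \<eta>) has_real_derivative \<eta> t) (at t)"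
    by (auto intro!: derivative_eq_intros)
  then show "(?\<Phi> has_real_derivative \<eta> t) (at t)"
  proof (rule has_field_derivative_transform_within_open[where S = "{c<..}"])
    show "t \<in> {c<..}" by (simp add: c_def)
  qed (simp_all add: eq)
qed

text \<open>The sets over which \<open>P\<close> integrates to \<open>0\<close> form a Dynkin system containing the half-lines.\<close>

lemma AE_zero_of_integral_rays:
  fixes P :: "real \<Rightarrow> real"
  assumes P: "integrable lborel P" and total: "(LINT r|lborel. P r) = 0"
    and rays: "\<And>a. (LINT r:{a<..}|lborel. P r) = 0"
  shows "AE r in lborel. P r = 0"
proof -
  have set_int: "set_integrable lborel A P" if "A \<in> sets borel" for A
    using integrable_mult_indicator[OF _ P] that by (simp add: set_integrable_def)
  have compl: "(LINT r:UNIV - A|lborel. P r) = - (LINT r:A|lborel. P r)" if "A \<in> sets borel" for A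
  proof -
    have "(LINT r:A \<union> (UNIV - A)|lborel. P r) = (LINT r:A|lborel. P r) + (LINT r:UNIV - A|lborel. P r)"
      using that by (intro set_integral_Un set_int) auto
    then show ?thesis using total by (simp add: set_lebesgue_integral_def)
  qed
  have zero: "(LINT r:A|lborel. P r) = 0" if A: "A \<in> sigma_sets UNIV (range atMost)" for A
  proof (rule sigma_sets_induct_disjoint[OF _ _ A, where P = "\<lambda>A. (LINT r:A|lborel. P r) = 0"])
    show "Int_stable (range (atMost :: real \<Rightarrow> _))" by (auto simp: Int_stable_def)
  next
    fix A assume "A \<in> range (atMost :: real \<Rightarrow> _)"
    then obtain a where a: "A = {..a}" by auto
    then have "UNIV - A = {a<..}" by auto
    with compl[of A] rays[of a] a show "(LINT r:A|lborel. P r) = 0" by simp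
  next
    fix A :: "real set" assume "A \<in> sigma_sets UNIV (range atMost)" "(LINT r:A|lborel. P r) = 0"
    then show "(LINT r:UNIV - A|lborel. P r) = 0"
      using compl[of A] by (simp add: borel_eq_atMost)
  next
    fix A :: "nat \<Rightarrow> real set"
    assume A: "disjoint_family A" "range A \<subseteq> sigma_sets UNIV (range atMost)" "\<And>i. (LINT r:A i|lborel. P r) = 0"
    then have "A i \<in> sets borel" for i by (auto simp: borel_eq_atMost)
    then have "(LINT r:(\<Union>i. A i)|lborel. P r) = (\<Sum>i. (LINT r:A i|lborel. P r))"
      using A(1) by (intro lebesgue_integral_countable_add set_int) (auto simp: disjoint_family_on_def)
    then show "(LINT r:(\<Union>i. A i)|lborel. P r) = 0" using A(3) by simp
  qed (auto simp: set_lebesgue_integral_def)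
  show ?thesis
    by (rule density_unique_real[OF P integrable_zero]) (simp add: zero borel_eq_atMost set_lebesgue_integral_def[of _ _ "\<lambda>_. 0"])
qed

lemma continuous_on_compact_norm_bound:
  assumes "compact S" "continuous_on S f"
  obtains B where "\<And>s. s \<in> S \<Longrightarrow> norm (f s) \<le> B"
proof -
  have "bounded (f ` S)"
    by (rule compact_imp_bounded[OF compact_continuous_image[OF assms(2,1)]])
  then show thesis using that unfolding bounded_iff by blast
qed

text \<open>A smooth approximation of the Heaviside function, used below with \<open>c = r\<^sup>2 - a\<^sup>2\<close>.\<close>

lemma flat_exp_steps_tendsto:
  "(\<lambda>k. flat_exp 0 (real k * c)) \<longlonglongrightarrow> (if 0 < c then 1 else 0)"
proof (cases "0 < c")
  case True
  have "filterlim (\<lambda>k. real k * c) at_top sequentially"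
    using True by (intro filterlim_at_top_mult_tendsto_pos[OF tendsto_const] filterlim_real_sequentially) auto
  then have "(\<lambda>k. inverse (real k * c)) \<longlonglongrightarrow> 0"
    by (rule tendsto_inverse_0_at_top)
  then have "(\<lambda>k. exp (- inverse (real k * c))) \<longlonglongrightarrow> exp (- 0)"
    by (intro tendsto_intros)
  then have "(\<lambda>k. exp (- inverse (real k * c))) \<longlonglongrightarrow> 1" by simp
  then have "(\<lambda>k. flat_exp 0 (real k * c)) \<longlonglongrightarrow> 1"
  proof (rule Lim_transform_eventually)
    show "\<forall>\<^sub>F k in sequentially. exp (- inverse (real k * c)) = flat_exp 0 (real k * c)"
      using eventually_gt_at_top[of 0] by eventually_elim (use True in \<open>simp add: flat_exp_def\<close>)
  qed
  then show ?thesis using True by simp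
next
  case False
  then have "flat_exp 0 (real k * c) = 0" for k
    by (intro flat_exp_eq_0) (simp add: mult_nonneg_nonpos)
  then show ?thesis using False by simp
qed

text \<open>Taking \<open>v r = u (r *\<^sub>R e\<^sub>0)\<close> for all real \<open>r\<close> makes \<open>v\<close> an even, continuous function on the whole line, so
  that no measurability question arises at negative arguments.\<close>

locale radial_p_laplace_solution = radial_W11_loc u G v e\<^sub>0
  for u :: "'a::euclidean_space \<Rightarrow> real" and G v e\<^sub>0 +
  fixes p \<alpha> q :: real
  assumes p1: "1 < p" and pN: "p < real DIM('a)" and pq: "p - 1 < q"
    and subcritical: "(q + 1) * (real DIM('a) - p) < p * (real DIM('a) + \<alpha>)"
    and v_line: "\<And>r. v r = u (r *\<^sub>R e\<^sub>0)"
    and u_pos: "\<And>x. 0 < u x"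
    and flux_integrable: "\<And>\<phi>. test_function UNIV \<phi> \<Longrightarrow>
        integrable lborel (\<lambda>x. (norm (G x) powr (p - 2) *\<^sub>R G x) \<bullet> grad \<phi> x)"
    and weak_equation: "\<And>\<phi>. test_function UNIV \<phi> \<Longrightarrow>
        (LINT x|lborel. (norm (G x) powr (p - 2) *\<^sub>R G x) \<bullet> grad \<phi> x) =
        (LINT x|lborel. norm x powr \<alpha> * u x powr q * \<phi> x)"
begin

lemma N_gt_1: "1 < DIM('a)"
  using p1 pN by linarith

lemma N_alpha_pos: "0 < real DIM('a) + \<alpha>"
proof -
  have "0 < (q + 1) * (real DIM('a) - p)" using p1 pN pq by simp
  with subcritical have "0 < p * (real DIM('a) + \<alpha>)" by linarith
  then show ?thesis using p1 by (simp add: zero_less_mult_iff)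
qed

lemma v_pos: "0 < v r"
  using u_pos v_line by simp

lemma v_cont: "continuous_on S v"
proof -
  have "continuous_on S (\<lambda>r. u (r *\<^sub>R e\<^sub>0))"
    by (rule continuous_on_compose2[OF u_cont]) (auto intro!: continuous_intros)
  then show ?thesis by (simp add: v_line[abs_def])
qed

lemma v_measurable [measurable]: "v \<in> borel_measurable borel"
  by (rule borel_measurable_continuous_onI[OF v_cont])

definition source :: "real \<Rightarrow> real" where
  "source s = s powr (real DIM('a) - 1 + \<alpha>) * v s powr q"

lemma source_measurable [measurable]: "source \<in> borel_measurable borel"
  unfolding source_def by measurable

lemma source_nonneg: "0 \<le> source s"
  by (simp add: source_def)

lemma source_isCont: "0 < s \<Longrightarrow> isCont source s"
  unfolding source_def using v_cont[of UNIV] v_pos[of s]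
  by (intro continuous_intros) (auto simp: continuous_on_eq_continuous_at)

lemma source_integrable: "set_integrable lborel {0..c} source"
proof (cases "0 \<le> c")
  case True
  have "(\<lambda>s. s powr (real DIM('a) - 1 + \<alpha>)) integrable_on {0..c}"
    using N_alpha_pos True by (intro integrable_on_powr_from_0) auto
  then have "(\<lambda>s. s powr (real DIM('a) - 1 + \<alpha>)) absolutely_integrable_on {0..c}"
    by (subst absolutely_integrable_on_iff_nonneg) auto
  then have int: "integrable lborel (\<lambda>s. indicat_real {0..c} s *\<^sub>R s powr (real DIM('a) - 1 + \<alpha>))"
    unfolding set_integrable_def by (subst (asm) integrable_completion) auto
  obtain B where B: "\<And>s. s \<in> {0..c} \<Longrightarrow> norm (v s) \<le> B"
    using continuous_on_compact_norm_bound[OF compact_Icc[of 0 c] v_cont] by blast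
  show ?thesis
    unfolding set_integrable_def
  proof (rule Bochner_Integration.integrable_bound[OF integrable_mult_right[OF int, of "B powr q"]])
    have "norm (indicat_real {0..c} s *\<^sub>R source s) \<le> norm (B powr q * (indicat_real {0..c} s *\<^sub>R s powr (real DIM('a) - 1 + \<alpha>)))" for s
    proof (cases "s \<in> {0..c}")
      case True
      have "v s powr q \<le> B powr q"
        using B[OF True] v_pos[of s] p1 pq by (intro powr_mono2) auto
      then show ?thesis using True by (simp add: source_def mult.commute mult_right_mono)
    qed simp
    then show "AE s in lborel. norm (indicat_real {0..c} s *\<^sub>R source s) \<le> norm (B powr q * (indicat_real {0..c} s *\<^sub>R s powr (real DIM('a) - 1 + \<alpha>)))"
      by simp
  qed measurable
next
  case False
  then have "{0..c} = {}" by simp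
  then show ?thesis by (simp add: set_integrable_def)
qed

definition F :: "real \<Rightarrow> real" where
  "F r = integral {0..r} source"

lemma source_integrable_on: "source integrable_on {0..c}"
  by (rule set_borel_integral_eq_integral(1)[OF source_integrable])

lemma F_nonneg: "0 \<le> F r"
  unfolding F_def by (intro Henstock_Kurzweil_Integration.integral_nonneg source_integrable_on) (simp add: source_nonneg)

lemma F_0: "F 0 = 0"
  by (simp add: F_def)

lemma F_cont: "continuous_on {0..c} F"
  unfolding F_def[abs_def] by (rule indefinite_integral_continuous_1[OF source_integrable_on])

lemma F_tendsto_0: "(F \<longlongrightarrow> 0) (at_right 0)"
proof -
  have "(F \<longlongrightarrow> F 0) (at 0 within {0..1})"
    using F_cont[of 1] by (auto simp: continuous_on_def)
  then show ?thesis by (simp add: F_0 at_within_Icc_at_right)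
qed

lemma F_has_derivative:
  assumes "0 < r" shows "(F has_real_derivative source r) (at r)"
proof -
  have "((\<lambda>x. integral {0..x} source) has_vector_derivative source r) (at r within ({0..r + 1} - {}))"
    by (rule integral_has_vector_derivative_continuous_at[OF source_integrable_on])
       (use assms source_isCont[OF assms] in \<open>auto intro: continuous_at_imp_continuous_at_within\<close>)
  then show ?thesis
    using assms by (simp add: F_def[abs_def] has_real_derivative_iff_has_vector_derivative at_within_Icc_at)
qed

definition flux :: "(real \<Rightarrow> real) \<Rightarrow> real \<Rightarrow> real" where
  "flux h r = \<bar>h r\<bar> powr (p - 2) * h r * r ^ (DIM('a) - 1)"

text \<open>The test function is \<open>\<psi> (x \<bullet> x)\<close>, where \<open>\<psi>\<close> is the antiderivative of \<open>\<eta>\<close> that vanishes from \<open>R\<^sup>2\<close> on. In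
  the radial variable the left side becomes the integral of \<open>flux h r * (2 * r * \<eta> (r\<^sup>2))\<close>; on the right side an
  integration by parts produces \<open>F\<close>. No boundary term appears at \<open>0\<close>, since \<open>F 0 = 0\<close>.\<close>

lemma weak_radial_identity:
  assumes R: "0 < R" and h[measurable]: "h \<in> borel_measurable borel"
    and Gh: "AE x in lborel. norm x < R \<longrightarrow> G x = (h (norm x) / norm x) *\<^sub>R x"
    and \<eta>: "smooth \<eta>" and \<eta>0: "\<And>t. R\<^sup>2 \<le> t \<Longrightarrow> \<eta> t = 0"
  shows "set_integrable lborel {0..} (\<lambda>r. (flux h r + F r) * (2 * r * \<eta> (r\<^sup>2)))"
    and "(LINT r:{0..}|lborel. (flux h r + F r) * (2 * r * \<eta> (r\<^sup>2))) = 0"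
proof -
  let ?\<omega> = "real DIM('a) * unit_ball_vol (real DIM('a))"
  have \<omega>: "0 < ?\<omega>" by simp
  have \<eta>_cont: "continuous_on S \<eta>" for S by (rule smooth_continuous_on[OF \<eta>])
  have [measurable]: "\<eta> \<in> borel_measurable borel"
    by (rule borel_measurable_continuous_onI[OF \<eta>_cont])
  obtain \<Phi> where \<Phi>: "\<And>t. (\<Phi> has_real_derivative \<eta> t) (at t)"
    using antiderivative_on_line[OF \<eta>_cont] by blast
  define \<psi> where "\<psi> = (\<lambda>t. \<Phi> t - \<Phi> (R\<^sup>2))"
  have d\<psi>: "(\<psi> has_real_derivative \<eta> t) (at t)" for t
    unfolding \<psi>_def using \<Phi>[of t] by (auto intro!: derivative_eq_intros)
  have \<psi>_smooth: "smooth \<psi>" by (rule smooth_antiderivative[OF \<eta> d\<psi>])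
  have \<psi>_cont: "continuous_on S \<psi>" for S by (rule smooth_continuous_on[OF \<psi>_smooth])
  have [measurable]: "\<psi> \<in> borel_measurable borel"
    by (rule borel_measurable_continuous_onI[OF \<psi>_cont])
  have \<psi>0: "\<psi> t = 0" if t: "R\<^sup>2 \<le> t" for t
  proof (cases "t = R\<^sup>2")
    case False
    with t have "R\<^sup>2 < t" by simp
    then have "\<psi> t = \<psi> (R\<^sup>2)"
      by (rule DERIV_isconst_end[OF _ \<psi>_cont]) (use d\<psi> \<eta>0 in \<open>metis less_imp_le\<close>)
    then show ?thesis by (simp add: \<psi>_def)
  qed (simp add: \<psi>_def)
  define \<phi> where "\<phi> = (\<lambda>x::'a. \<psi> ((x - 0) \<bullet> (x - 0)))"
  have \<phi>: "test_function UNIV \<phi>"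
    unfolding \<phi>_def by (rule test_function_radial[OF \<psi>_smooth \<psi>0])
  have grad_\<phi>: "grad \<phi> x = (2 * \<eta> ((norm x)\<^sup>2)) *\<^sub>R x" for x
    unfolding \<phi>_def by (subst grad_radial[OF d\<psi>]) (simp add: dot_square_norm)
  define k where "k = (\<lambda>r. \<bar>h r\<bar> powr (p - 2) * h r * (2 * r * \<eta> (r\<^sup>2)))"
  have [measurable]: "k \<in> borel_measurable borel" unfolding k_def by measurable
  define W where "W = (\<lambda>x. (norm (G x) powr (p - 2) *\<^sub>R G x) \<bullet> grad \<phi> x)"
  have W_int: "integrable lborel W" unfolding W_def by (rule flux_integrable[OF \<phi>])
  then have [measurable]: "W \<in> borel_measurable borel" by auto
  have AEk: "AE x in lborel. W x = k (norm x)"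
    unfolding W_def
    using Gh AE_lborel_singleton[of 0]
  proof eventually_elim
    case (elim x)
    show ?case
    proof (cases "norm x < R")
      case True
      with elim have Gx: "G x = (h (norm x) / norm x) *\<^sub>R x" and "norm (G x) = \<bar>h (norm x)\<bar>" by auto
      then have "(norm (G x) powr (p - 2) *\<^sub>R G x) \<bullet> grad \<phi> x
          = \<bar>h (norm x)\<bar> powr (p - 2) * (h (norm x) / norm x) * (2 * \<eta> ((norm x)\<^sup>2)) * (x \<bullet> x)"
        by (simp add: grad_\<phi>)
      also have "\<dots> = k (norm x)"
        using elim by (simp add: k_def dot_square_norm power2_eq_square)
      finally show ?thesis .
    next
      case False
      then have "R\<^sup>2 \<le> (norm x)\<^sup>2" using R by (intro power_mono) auto
      then show ?thesis by (simp add: grad_\<phi> k_def \<eta>0)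
    qed
  qed
  have "integrable lborel (\<lambda>x::'a. k (norm x))"
    using integrable_cong_AE[of W lborel "\<lambda>x. k (norm x)"] AEk W_int by simp
  then have k_int: "set_integrable lborel {0..} (\<lambda>r. r ^ (DIM('a) - 1) * k r)"
    by (subst (asm) integrable_norm_iff) simp_all
  have "(LINT x|lborel. W x) = (LINT x|lborel. k (norm (x::'a)))"
    by (rule integral_cong_AE) (use AEk in simp_all)
  also have "\<dots> = ?\<omega> * (LINT r:{0..}|lborel. r ^ (DIM('a) - 1) * k r)"
    by (rule integral_norm) measurable
  finally have lhs: "(LINT x|lborel. W x) = ?\<omega> * (LINT r:{0..}|lborel. r ^ (DIM('a) - 1) * k r)" .
  define g where "g = (\<lambda>r. r powr \<alpha> * v r powr q * \<psi> (r\<^sup>2))"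
  have [measurable]: "g \<in> borel_measurable borel" unfolding g_def by measurable
  \<comment> \<open>At \<open>r = 0\<close> both sides vanish because the dimension exceeds \<open>1\<close>.\<close>
  have g_eq: "r ^ (DIM('a) - 1) * g r = source r * \<psi> (r\<^sup>2)" if "0 \<le> r" for r
  proof (cases "r = 0")
    case False
    then have "r powr (real DIM('a) - 1 + \<alpha>) = r ^ (DIM('a) - 1) * r powr \<alpha>"
      using that N_gt_1 by (simp add: powr_add powr_realpow[symmetric] of_nat_diff)
    then show ?thesis by (simp add: g_def source_def)
  qed (use N_gt_1 in \<open>simp add: source_def\<close>)
  have "(LINT x|lborel. norm x powr \<alpha> * u x powr q * \<phi> x) = (LINT x|lborel. g (norm (x::'a)))"
    by (simp add: g_def \<phi>_def u_radial dot_square_norm)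
  also have "\<dots> = ?\<omega> * (LINT r:{0..}|lborel. r ^ (DIM('a) - 1) * g r)"
    by (rule integral_norm) measurable
  also have "(LINT r:{0..}|lborel. r ^ (DIM('a) - 1) * g r) = (LINT r:{0..R}|lborel. source r * \<psi> (r\<^sup>2))"
    unfolding set_lebesgue_integral_def
  proof (intro Bochner_Integration.integral_cong refl)
    fix r
    have "\<psi> (r\<^sup>2) = 0" if "R < r" using that R by (intro \<psi>0 power_mono) auto
    then show "indicat_real {0..} r *\<^sub>R (r ^ (DIM('a) - 1) * g r) = indicat_real {0..R} r *\<^sub>R (source r * \<psi> (r\<^sup>2))"
      using g_eq[of r] R by (cases "0 \<le> r"; cases "r \<le> R") (simp_all del: mult_eq_0_iff)
  qed
  finally have rhs: "(LINT x|lborel. norm x powr \<alpha> * u x powr q * \<phi> x)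
      = ?\<omega> * (LINT r:{0..R}|lborel. source r * \<psi> (r\<^sup>2))" .
  have "?\<omega> * (LINT r:{0..}|lborel. r ^ (DIM('a) - 1) * k r) = ?\<omega> * (LINT r:{0..R}|lborel. source r * \<psi> (r\<^sup>2))"
    using lhs rhs weak_equation[OF \<phi>, folded W_def] by (simp only:)
  then have main: "(LINT r:{0..}|lborel. r ^ (DIM('a) - 1) * k r) = (LINT r:{0..R}|lborel. source r * \<psi> (r\<^sup>2))"
    by (rule mult_left_cancel[THEN iffD1, rotated]) (use \<omega> in linarith)
  have F_cont': "continuous_on {0..R} (\<lambda>r. F r * (2 * r * \<eta> (r\<^sup>2)))"
    by (intro continuous_intros F_cont continuous_on_compose2[OF \<eta>_cont[of UNIV]]) auto
  have parts: "((\<lambda>r. source r * \<psi> (r\<^sup>2)) has_integral - integral {0..R} (\<lambda>r. F r * (2 * r * \<eta> (r\<^sup>2)))) {0..R}"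
  proof (rule integration_by_parts_interior[OF bounded_bilinear_mult])
    show "continuous_on {0..R} F" by (rule F_cont)
    show "continuous_on {0..R} (\<lambda>r. \<psi> (r\<^sup>2))"
      by (intro continuous_on_compose2[OF \<psi>_cont[of UNIV]] continuous_intros) auto
    show "(F has_vector_derivative source r) (at r)" if "r \<in> {0<..<R}" for r
      using F_has_derivative[of r] that by (simp add: has_real_derivative_iff_has_vector_derivative)
    show "((\<lambda>r. \<psi> (r\<^sup>2)) has_vector_derivative 2 * r * \<eta> (r\<^sup>2)) (at r)" for r
    proof -
      have "((\<lambda>r. r\<^sup>2) has_real_derivative 2 * r) (at r)"
        by (auto intro!: derivative_eq_intros)
      from DERIV_chain2[OF d\<psi> this] show ?thesis
        by (simp add: has_real_derivative_iff_has_vector_derivative mult.commute)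
    qed
    have "((\<lambda>r. F r * (2 * r * \<eta> (r\<^sup>2))) has_integral integral {0..R} (\<lambda>r. F r * (2 * r * \<eta> (r\<^sup>2)))) {0..R}"
      by (rule integrable_integral[OF integrable_continuous_real[OF F_cont']])
    then show "((\<lambda>r. F r * (2 * r * \<eta> (r\<^sup>2))) has_integral
        F R * \<psi> (R\<^sup>2) - F 0 * \<psi> (0\<^sup>2) - - integral {0..R} (\<lambda>r. F r * (2 * r * \<eta> (r\<^sup>2)))) {0..R}"
      using \<psi>0[of "R\<^sup>2"] by (simp add: F_0)
  qed (use R in simp)
  have cont_bdd: "set_integrable lborel {0..R} (\<lambda>r. source r * \<psi> (r\<^sup>2))"
  proof -
    have "continuous_on {0..R} (\<lambda>r. \<psi> (r\<^sup>2))"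
      by (intro continuous_on_compose2[OF \<psi>_cont[of UNIV]] continuous_intros) auto
    from continuous_on_compact_norm_bound[OF compact_Icc this]
    obtain B where B: "\<And>r. r \<in> {0..R} \<Longrightarrow> norm (\<psi> (r\<^sup>2)) \<le> B" by blast
    show ?thesis
      unfolding set_integrable_def
    proof (rule Bochner_Integration.integrable_bound[OF integrable_mult_right[OF source_integrable[of R, unfolded set_integrable_def], of B]])
      have "norm (indicat_real {0..R} r *\<^sub>R (source r * \<psi> (r\<^sup>2))) \<le> norm (B * (indicat_real {0..R} r *\<^sub>R source r))" for r
      proof (cases "r \<in> {0..R}")
        case True
        have "\<bar>\<psi> (r\<^sup>2)\<bar> * \<bar>source r\<bar> \<le> \<bar>B\<bar> * \<bar>source r\<bar>"
          using B[OF True] by (intro mult_right_mono) auto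
        then show ?thesis using True by (simp add: abs_mult mult.commute)
      qed simp
      then show "AE r in lborel. norm (indicat_real {0..R} r *\<^sub>R (source r * \<psi> (r\<^sup>2))) \<le> norm (B * (indicat_real {0..R} r *\<^sub>R source r))"
        by simp
    qed measurable
  qed
  have ind: "indicat_real {0..} r *\<^sub>R (F r * (2 * r * \<eta> (r\<^sup>2))) = indicat_real {0..R} r *\<^sub>R (F r * (2 * r * \<eta> (r\<^sup>2)))" for r
  proof -
    have "\<eta> (r\<^sup>2) = 0" if "R < r" using that R by (intro \<eta>0 power_mono) auto
    then show ?thesis by (auto simp: indicator_def)
  qed
  have F_int: "set_integrable lborel {0..R} (\<lambda>r. F r * (2 * r * \<eta> (r\<^sup>2)))"
    by (rule borel_integrable_atLeastAtMost'[OF F_cont'])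
  then have F_int': "set_integrable lborel {0..} (\<lambda>r. F r * (2 * r * \<eta> (r\<^sup>2)))"
    by (simp only: set_integrable_def ind)
  have "(LINT r:{0..}|lborel. F r * (2 * r * \<eta> (r\<^sup>2))) = (LINT r:{0..R}|lborel. F r * (2 * r * \<eta> (r\<^sup>2)))"
    by (simp only: set_lebesgue_integral_def ind)
  also have "\<dots> = integral {0..R} (\<lambda>r. F r * (2 * r * \<eta> (r\<^sup>2)))"
    by (rule set_borel_integral_eq_integral(2)[OF F_int])
  also have "\<dots> = - (LINT r:{0..}|lborel. r ^ (DIM('a) - 1) * k r)"
    unfolding main set_borel_integral_eq_integral(2)[OF cont_bdd] using integral_unique[OF parts] by simp
  finally have sum: "(LINT r:{0..}|lborel. r ^ (DIM('a) - 1) * k r) + (LINT r:{0..}|lborel. F r * (2 * r * \<eta> (r\<^sup>2))) = 0"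
    by simp
  have split: "(\<lambda>r. (flux h r + F r) * (2 * r * \<eta> (r\<^sup>2))) = (\<lambda>r. r ^ (DIM('a) - 1) * k r + F r * (2 * r * \<eta> (r\<^sup>2)))"
    by (simp add: fun_eq_iff flux_def k_def algebra_simps)
  show "set_integrable lborel {0..} (\<lambda>r. (flux h r + F r) * (2 * r * \<eta> (r\<^sup>2)))"
    unfolding split by (rule set_integral_add(1)[OF k_int F_int'])
  show "(LINT r:{0..}|lborel. (flux h r + F r) * (2 * r * \<eta> (r\<^sup>2))) = 0"
    unfolding split set_integral_add(2)[OF k_int F_int'] by (rule sum)
qed

text \<open>In \<open>weak_radial_identity\<close> take for \<open>\<eta>\<close> a fixed bump, positive below \<open>R\<^sup>2\<close>, times smooth steps at
  \<open>a\<^sup>2\<close>. In the limit the integrand \<open>P\<close> for the bump alone integrates to \<open>0\<close> over every half-line, hence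
  vanishes almost everywhere.\<close>

lemma flux_eq:
  assumes R: "0 < R" and h[measurable]: "h \<in> borel_measurable borel"
    and Gh: "AE x in lborel. norm x < R \<longrightarrow> G x = (h (norm x) / norm x) *\<^sub>R x"
  shows "AE r in lborel. 0 < r \<and> r < R \<longrightarrow> flux h r = - F r"
proof -
  define \<eta> where "\<eta> = (\<lambda>t. flat_exp 0 (R\<^sup>2 - t))"
  define P where "P = (\<lambda>r. indicat_real {0..} r *\<^sub>R ((flux h r + F r) * (2 * r * \<eta> (r\<^sup>2))))"
  have lin: "smooth (\<lambda>t::real. a * t + b)" for a b
    by (intro smooth_add smooth_const smooth_mult smooth_linear bounded_linear_ident)
  have \<eta>: "smooth \<eta>"
    using smooth_compose_real[OF smooth_flat_exp[of 0] lin[of "-1" "R\<^sup>2"]] by (simp add: \<eta>_def)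
  have \<eta>0: "\<eta> t = 0" if "R\<^sup>2 \<le> t" for t using that by (simp add: \<eta>_def flat_exp_eq_0)
  have P_int: "integrable lborel P"
    using weak_radial_identity(1)[OF R h Gh \<eta> \<eta>0] by (simp add: P_def set_integrable_def)
  have ray: "(LINT r:{a<..}|lborel. P r) = 0" if a: "0 \<le> a" for a
  proof -
    let ?s = "\<lambda>k r. flat_exp 0 (real k * (r\<^sup>2 - a\<^sup>2))"
    have s_measurable[measurable]: "?s k \<in> borel_measurable borel" for k
      by (intro borel_measurable_continuous_onI continuous_intros)
    have "(LINT r|lborel. ?s k r * P r) = 0" for k
    proof -
      have "smooth (\<lambda>t. \<eta> t * flat_exp 0 (real k * t + - (real k * a\<^sup>2)))"
        by (intro smooth_mult \<eta> smooth_compose_real[OF smooth_flat_exp] lin)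
      then have "smooth (\<lambda>t. \<eta> t * flat_exp 0 (real k * (t - a\<^sup>2)))"
        by (simp add: right_diff_distrib)
      from weak_radial_identity(2)[OF R h Gh this] \<eta>0 show ?thesis
        by (simp add: P_def set_lebesgue_integral_def mult_ac)
    qed
    moreover have "(\<lambda>k. LINT r|lborel. ?s k r * P r) \<longlonglongrightarrow> (LINT r|lborel. indicator {a<..} r *\<^sub>R P r)"
    proof (rule integral_dominated_convergence[where w = "\<lambda>r. norm (P r)"])
      show "AE r in lborel. (\<lambda>k. ?s k r * P r) \<longlonglongrightarrow> indicator {a<..} r *\<^sub>R P r"
      proof (rule AE_I2)
        fix r :: real
        show "(\<lambda>k. ?s k r * P r) \<longlonglongrightarrow> indicator {a<..} r *\<^sub>R P r"
        proof (cases "0 \<le> r")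
          case True
          then have iff: "a\<^sup>2 < r\<^sup>2 \<longleftrightarrow> a < r"
            using a by (simp add: not_le[symmetric])
          show ?thesis
            using tendsto_mult[OF flat_exp_steps_tendsto[of "r\<^sup>2 - a\<^sup>2"] tendsto_const[of "P r"]]
            by (auto simp: iff indicator_def split: if_splits)
        next
          case False
          then show ?thesis by (simp add: P_def)
        qed
      qed
      show "AE r in lborel. norm (?s k r * P r) \<le> norm (P r)" for k
      proof (rule AE_I2)
        fix r
        have "\<bar>?s k r\<bar> * \<bar>P r\<bar> \<le> 1 * \<bar>P r\<bar>"
          using flat_exp_0_le_1 flat_exp_nonneg by (intro mult_right_mono) (simp_all add: abs_of_nonneg)
        then show "norm (?s k r * P r) \<le> norm (P r)" by (simp add: abs_mult)
      qed
    qed (use P_int in \<open>auto\<close>)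
    ultimately show ?thesis
      by (simp add: set_lebesgue_integral_def LIMSEQ_const_iff)
  qed
  have P0: "indicat_real {0<..} r *\<^sub>R P r = P r" for r
    by (auto simp: P_def indicator_def)
  have total: "(LINT r|lborel. P r) = 0"
    using ray[of 0] by (simp add: set_lebesgue_integral_def P0 del: real_scaleR_def)
  have "AE r in lborel. P r = 0"
  proof (rule AE_zero_of_integral_rays[OF P_int total])
    fix a :: real
    show "(LINT r:{a<..}|lborel. P r) = 0"
    proof (cases "0 \<le> a")
      case False
      then have "indicat_real {a<..} r *\<^sub>R P r = P r" for r
        by (auto simp: P_def indicator_def)
      then show ?thesis using total by (simp add: set_lebesgue_integral_def del: real_scaleR_def)
    qed (rule ray)
  qed
  then show ?thesis
  proof eventually_elim
    case (elim r)
    show ?case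
    proof (intro impI, elim conjE)
      assume r: "0 < r" "r < R"
      then have "r\<^sup>2 < R\<^sup>2" by (intro power_strict_mono) auto
      then have "0 < \<eta> (r\<^sup>2)" by (simp add: \<eta>_def flat_exp_pos)
      with elim r show "flux h r = - F r" by (simp add: P_def)
    qed
  qed
qed

definition slope :: "real \<Rightarrow> real" where
  "slope r = - ((F r * r powr (1 - real DIM('a))) powr (1 / (p - 1)))"

text \<open>Since \<open>F\<close> is nonnegative, the flux identity forces \<open>h r \<le> 0\<close> and determines \<open>\<bar>h r\<bar>\<close>.\<close>

lemma slope_of_flux:
  assumes r: "0 < r" and eq: "flux h r = - F r"
  shows "h r = slope r"
proof (cases "h r = 0")
  \<comment> \<open>Here \<open>slope r = 0\<close> by the convention \<open>0 powr x = 0\<close>.\<close>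
  case True
  then have "F r = 0" using eq by (simp add: flux_def)
  then show ?thesis using True by (simp add: slope_def)
next
  case False
  have rN: "0 < r ^ (DIM('a) - 1)" using r by simp
  have "\<bar>h r\<bar> powr (p - 2) * h r * r ^ (DIM('a) - 1) \<le> 0"
    using eq F_nonneg[of r] by (simp add: flux_def)
  then have neg: "h r < 0"
    using False rN by (simp add: mult_le_0_iff zero_less_mult_iff not_less)
  have pw: "\<bar>h r\<bar> powr (p - 2) * \<bar>h r\<bar> = \<bar>h r\<bar> powr (p - 1)"
    using powr_add[of "\<bar>h r\<bar>" "p - 2" 1] False by simp
  have "\<bar>h r\<bar> powr (p - 1) * r ^ (DIM('a) - 1) = - flux h r"
    unfolding pw[symmetric] flux_def using neg by simp
  then have "\<bar>h r\<bar> powr (p - 1) * r ^ (DIM('a) - 1) = F r"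
    using eq by simp
  moreover have "r powr (1 - real DIM('a)) = inverse (r ^ (DIM('a) - 1))"
    using r N_gt_1 by (simp add: powr_realpow[symmetric] powr_minus[symmetric] of_nat_diff)
  ultimately have "F r * r powr (1 - real DIM('a)) = \<bar>h r\<bar> powr (p - 1)"
    using rN by (metis divide_inverse less_irrefl nonzero_mult_div_cancel_right)
  then have "slope r = - \<bar>h r\<bar>"
    using p1 by (simp add: slope_def powr_powr)
  then show ?thesis using neg by simp
qed

lemma slope_cont: "0 < a \<Longrightarrow> continuous_on {a..b} slope"
  unfolding slope_def
  by (intro continuous_intros continuous_on_powr' continuous_on_subset[OF F_cont[of b]])
     (use p1 F_nonneg in \<open>auto intro!: mult_nonneg_nonneg\<close>)

text \<open>The function \<open>h\<close> agrees almost everywhere with the continuous function \<open>slope\<close>, so the integrated derivative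
  of \<open>v\<close> is a classical one.\<close>

lemma v_has_derivative:
  assumes r: "0 < r"
  shows "(v has_real_derivative slope r) (at r)"
proof -
  define R where "R = r + 2"
  have R: "0 < R" using r by (simp add: R_def)
  obtain h where h: "h \<in> borel_measurable borel"
      "AE x in lborel. norm x < R \<longrightarrow> G x = (h (norm x) / norm x) *\<^sub>R x"
      "\<And>a b. \<lbrakk>0 < a; a \<le> b; b < R\<rbrakk> \<Longrightarrow> set_integrable lborel {a..b} h"
      "\<And>a b. \<lbrakk>0 < a; a \<le> b; b < R\<rbrakk> \<Longrightarrow> v b - v a = (LINT r:{a..b}|lborel. h r)"
    using gradient_radial_profile[OF R] by blast
  define a where "a = r / 2"
  have a: "0 < a" "a < r" using r by (auto simp: a_def)
  have v_int: "v b = v a + integral {a..b} slope" if b: "a \<le> b" "b < R" for b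
  proof -
    have int: "set_integrable lborel {a..b} slope"
      by (rule borel_integrable_atLeastAtMost'[OF slope_cont[OF a(1)]])
    have "(LINT r:{a..b}|lborel. h r) = (LINT r:{a..b}|lborel. slope r)"
      unfolding set_lebesgue_integral_def
    proof (rule integral_cong_AE)
      show "(\<lambda>r. indicat_real {a..b} r *\<^sub>R h r) \<in> borel_measurable lborel"
        using h(1) by measurable
      show "(\<lambda>r. indicat_real {a..b} r *\<^sub>R slope r) \<in> borel_measurable lborel"
        using int unfolding set_integrable_def by auto
      show "AE r in lborel. indicat_real {a..b} r *\<^sub>R h r = indicat_real {a..b} r *\<^sub>R slope r"
        using flux_eq[OF R h(1,2)]
      proof eventually_elim
        case (elim s)
        show ?case
        proof (cases "s \<in> {a..b}")
          case True
          then have "h s = slope s" using elim a b by (intro slope_of_flux) auto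
          then show ?thesis by simp
        qed simp
      qed
    qed
    also have "\<dots> = integral {a..b} slope"
      by (rule set_borel_integral_eq_integral(2)[OF int])
    finally show ?thesis using h(4)[OF a(1) b] by simp
  qed
  have "((\<lambda>b. integral {a..b} slope) has_real_derivative slope r) (at r within {a..r + 1})"
    by (rule integral_has_real_derivative[OF slope_cont[OF a(1)]]) (use a in auto)
  then have "((\<lambda>b. integral {a..b} slope) has_real_derivative slope r) (at r)"
    using a by (simp add: at_within_Icc_at)
  then have "((\<lambda>b. v a + integral {a..b} slope) has_real_derivative slope r) (at r)"
    by (auto intro!: derivative_eq_intros)
  then show ?thesis
  proof (rule has_field_derivative_transform_within_open[where S = "{a<..<R}"])
    show "v a + integral {a..b} slope = v b" if "b \<in> {a<..<R}" for b
      by (rule v_int[symmetric]) (use that in auto)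
  qed (use a in \<open>auto simp: R_def\<close>)
qed

lemma no_positive_solution: False
proof -
  have "radial_ode p q (real DIM('a)) \<alpha> v F"
  proof
    show "(v has_real_derivative - ((F r * r powr (1 - real DIM('a))) powr (1 / (p - 1)))) (at r)" if "0 < r" for r
      using v_has_derivative[OF that] by (simp add: slope_def)
    show "(F has_real_derivative r powr (real DIM('a) - 1 + \<alpha>) * v r powr q) (at r)" if "0 < r" for r
      using F_has_derivative[OF that] N_gt_1 by (simp add: source_def of_nat_diff)
    obtain B where B: "\<And>s. s \<in> {0..1} \<Longrightarrow> norm (v s) \<le> B"
      using continuous_on_compact_norm_bound[OF compact_Icc[of 0 1] v_cont] by blast
    have "v r \<le> B" if "0 < r" "r \<le> 1" for r
      using B[of r] that by simp
    then show "\<exists>B. \<forall>r. 0 < r \<longrightarrow> r \<le> 1 \<longrightarrow> v r \<le> B"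
      by blast
  qed (use p1 pN pq subcritical v_pos F_tendsto_0 in auto)
  then show False by (rule radial_ode.no_entire_solution)
qed

end

theorem theorem1p3:
  fixes p \<alpha> q :: real
  assumes "CARD('n::finite) \<ge> 2"
    and "1 < p" and "p < real CARD('n)"
    and "p - 1 < q" and "q < (real CARD('n) + \<alpha>) * p / (real CARD('n) - p) - 1"
  shows "\<not> (\<exists>u :: real ^ 'n \<Rightarrow> real.
            p_laplace_solution p \<alpha> q UNIV u \<and> (\<forall>x. u x > 0) \<and> radial u)"
proof
  assume "\<exists>u :: real ^ 'n \<Rightarrow> real. p_laplace_solution p \<alpha> q UNIV u \<and> (\<forall>x. u x > 0) \<and> radial u"
  then obtain u :: "real ^ 'n \<Rightarrow> real" where
    sol: "p_laplace_solution p \<alpha> q UNIV u" and u_pos: "\<And>x. 0 < u x" and "radial u"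
    by blast
  then obtain v\<^sub>0 where v0: "\<And>x. u x = v\<^sub>0 (norm x)"
    unfolding radial_def by blast
  from sol obtain G where u: "continuous_on UNIV u" and G: "weak_gradient UNIV u G"
    and weak: "\<And>\<phi>. test_function UNIV \<phi> \<Longrightarrow>
          set_integrable lborel UNIV (\<lambda>x. (norm (G x) powr (p - 2) *\<^sub>R G x) \<bullet> grad \<phi> x) \<and>
          (LINT x:UNIV|lborel. (norm (G x) powr (p - 2) *\<^sub>R G x) \<bullet> grad \<phi> x) =
          (LINT x:UNIV|lborel. norm x powr \<alpha> * u x powr q * \<phi> x)"
    unfolding p_laplace_solution_def by blast
  obtain e :: "real ^ 'n" where e: "e \<in> Basis" using nonempty_Basis by blast
  have "(q + 1) * (real CARD('n) - p) < p * (real CARD('n) + \<alpha>)"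
    using assms by (simp add: pos_less_divide_eq less_diff_eq mult.commute)
  then interpret radial_p_laplace_solution u G "\<lambda>r. u (r *\<^sub>R e)" e p \<alpha> q
    using assms u u_pos G weak e
    by unfold_locales (simp_all add: v0 set_integrable_def set_lebesgue_integral_def)
  show False by (rule no_positive_solution)
qed

end
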